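(* Let $U$ be a domain in $\mathbb C^n$. Let $f$ be a holomorphic nonconstant function on $U$ with $|f|<\frac12$ on $U$, and let $v=\frac{1}{\ln|f|}$ on $U$, with $v=0$ on $f^{-1}(0)$. The following statements hold. 1) $v\in W^{1,2}_{loc}(U)$. 2) If $f^{-1}(0)\neq\emptyset$, then $v\notin W^{1,p}_{loc}(U)$ for any $p>2$.
   Context: A domain is a nonempty connected open set; $\mathbb C^n$ is identified with $\mathbb R^{2n}$. $f^{-1}(0)=\{z\in U: f(z)=0\}$. Since $|f|<\frac12$, $v$ is well defined and continuous on $U$ with the convention $v=0$ on $f^{-1}(0)$. $W^{1,p}_{loc}(U)$ is the Sobolev space of functions on $U$ in $L^p_{loc}(U)$ whose first-order weak derivatives (with respect to the real coordinates) exist and belong to $L^p_{loc}(U)$. *)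

theory Defs
  imports "HOL-Analysis.Analysis"
begin

text \<open>
  The type \<^typ>\<open>complex ^ 'n\<close> with its euclidean structure is the identification of complex
  n-space with real 2n-space: its \<^term>\<open>Basis\<close> consists of the vectors \<^term>\<open>axis i 1\<close> and
  \<^term>\<open>axis i \<i>\<close>, i.e. of the real coordinate directions, and \<^term>\<open>lebesgue\<close> is the
  2n-dimensional Lebesgue measure.
\<close>

text \<open>
  Holomorphy in several variables: complex differentiability, i.e. the real Frechet derivative
  exists and is complex linear.
\<close>

definition holomorphic_vec_on :: "(complex ^ 'n \<Rightarrow> complex) \<Rightarrow> (complex ^ 'n) set \<Rightarrow> bool"
  where "holomorphic_vec_on f U \<longleftrightarrow>
    (\<forall>z\<in>U. \<exists>D. (f has_derivative D) (at z within U) \<and> (\<forall>c w. D (c *s w) = c * D w))"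

primrec Ck :: "nat \<Rightarrow> ('a::euclidean_space \<Rightarrow> real) \<Rightarrow> bool"
  where
    "Ck 0 \<phi> \<longleftrightarrow> continuous_on UNIV \<phi>"
  | "Ck (Suc k) \<phi> \<longleftrightarrow> \<phi> differentiable_on UNIV \<and>
       (\<forall>b\<in>Basis. Ck k (\<lambda>x. frechet_derivative \<phi> (at x) b))"

text \<open>Test functions on \<^term>\<open>U\<close> are taken to be extended by zero to the whole space.\<close>

definition test_functions :: "'a::euclidean_space set \<Rightarrow> ('a \<Rightarrow> real) set"
  where "test_functions U =
    {\<phi>. (\<forall>k. Ck k \<phi>) \<and> compact (closure {x. \<phi> x \<noteq> 0}) \<and> closure {x. \<phi> x \<noteq> 0} \<subseteq> U}"

text \<open>
  Local Lebesgue spaces, for exponents \<open>1 \<le> p \<le> \<infinity>\<close>. Elements are functions rather than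
  classes modulo null sets, and only their values on \<^term>\<open>U\<close> matter.
\<close>

definition Lp_loc :: "ennreal \<Rightarrow> 'a::euclidean_space set \<Rightarrow> ('a \<Rightarrow> real) set"
  where "Lp_loc p U =
    {g. g \<in> borel_measurable (lebesgue_on U) \<and>
        (\<forall>K. compact K \<and> K \<subseteq> U \<longrightarrow>
          (if p = \<infinity> then \<exists>C. AE x in lebesgue_on K. \<bar>g x\<bar> \<le> C
           else integrable (lebesgue_on K) (\<lambda>x. \<bar>g x\<bar> powr enn2real p)))}"

text \<open>
  The local integrability requirements ensure that both integrals exist, so the default value
  of the Bochner integral never enters.
\<close>

definition has_weak_partial ::
    "'a::euclidean_space set \<Rightarrow> 'a \<Rightarrow> ('a \<Rightarrow> real) \<Rightarrow> ('a \<Rightarrow> real) \<Rightarrow> bool"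
  where "has_weak_partial U b u g \<longleftrightarrow>
    u \<in> Lp_loc 1 U \<and> g \<in> Lp_loc 1 U \<and>
    (\<forall>\<phi>\<in>test_functions U.
      (LINT x|lebesgue_on U. u x * frechet_derivative \<phi> (at x) b) =
      - (LINT x|lebesgue_on U. g x * \<phi> x))"

definition W1_loc :: "ennreal \<Rightarrow> 'a::euclidean_space set \<Rightarrow> ('a \<Rightarrow> real) set"
  where "W1_loc p U =
    {u. u \<in> Lp_loc p U \<and> (\<forall>b\<in>Basis. \<exists>g\<in>Lp_loc p U. has_weak_partial U b u g)}"

end

theory Submission
  imports Defs "HOL-Complex_Analysis.Complex_Analysis"
begin

text \<open>
  Where \<open>f\<close> does not vanish, \<open>\<nabla>v\<close> has size \<open>|\<partial>f| / (|f| ln\<^sup>2|f|)\<close>. Local square integrability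
  comes from a Caccioppoli estimate: integrating the \<open>cnj z\<^sub>i\<close>-derivative of
  \<open>\<eta>\<^sup>2 cnj f \<partial>\<^sub>if / (X (4 - ln X))\<close> with \<open>X = |f|\<^sup>2 + \<epsilon>\<close> and a cutoff \<open>\<eta>\<close> bounds
  \<open>\<integral> \<eta>\<^sup>2 |\<partial>\<^sub>if|\<^sup>2 / (X (4 - ln X)\<^sup>2)\<close> uniformly in \<open>\<epsilon>\<close>, and Fatou's lemma lets \<open>\<epsilon> \<rightarrow> 0\<close>. The same
  bound dominates the derivatives of \<open>2 / ln X\<close>, so the pointwise derivative of \<open>v\<close>, set to 0
  on the zero set, is the weak one.

  For \<open>p > 2\<close>, weak derivatives being unique, it suffices that the pointwise gradient is not
  locally in \<open>L\<^sup>p\<close>. Since the zero set has empty interior, some zero \<open>a\<close> is an isolated zero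
  of \<open>f\<close> along a coordinate axis. By the minimum modulus principle \<open>f\<close> then has a zero on
  each parallel line near \<open>a\<close>. On such a line the \<open>p\<close>-th power of the gradient exceeds
  \<open>|t - \<xi>|\<^sup>-\<^sup>2\<close> near the zero \<open>\<xi>\<close>, which is not integrable, and Tonelli's theorem concludes.
\<close>

text \<open>The obstacle is that the zero set can be singular, so it cannot be straightened by local
  coordinates; the Caccioppoli argument never looks at its shape. With \<open>g\<close> the
  \<open>i\<close>-th partial derivative, the field \<open>cnj f * g / (X * (4 - ln X))\<close> is
  the complex derivative of \<open>- ln (4 - ln X)\<close>, a regularized and shifted potential of
  the Poincare metric of the punctured disc, pulled back by \<open>f\<close>. Its mixed second
  derivative dominates the density to be bounded, so integrating by parts against the cutoff leaves
  only derivatives of the cutoff. The gradient of \<open>v\<close> has the square of a logarithm in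
  its denominator, the square root of that density only the first power, so the density suffices.

  The shift 4 makes \<open>x * (4 - 2 * ln x)\<close> increasing on all of (0, 1], whereas
  \<open>- x * ln x\<close> decreases beyond 1/e, which lies below the bound 1/2 on |f|. This
  monotonicity gives one dominating function for all regularized gradients.\<close>

subsection \<open>Smooth functions\<close>

lemma Ck_SucD: "Ck (Suc k) \<phi> \<Longrightarrow> Ck k \<phi>"
proof (induction k arbitrary: \<phi>)
  case 0
  then show ?case by (auto intro: differentiable_imp_continuous_on)
next
  case (Suc k)
  then show ?case by (metis Ck.simps(2))
qed

lemma Ck_SucI:
  assumes "\<And>x. (\<phi> has_derivative \<phi>' x) (at x)"
    and "\<And>b. b \<in> Basis \<Longrightarrow> Ck k (\<lambda>x. \<phi>' x b)"
  shows "Ck (Suc k) \<phi>"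
proof -
  have "(\<lambda>x. frechet_derivative \<phi> (at x) b) = (\<lambda>x. \<phi>' x b)" for b
    using frechet_derivative_at[OF assms(1)] by metis
  then show ?thesis
    using assms by (auto simp: differentiable_on_def differentiable_def)
qed

lemma Ck_const: "Ck k (\<lambda>x. c)"
proof (induction k arbitrary: c)
  case (Suc k)
  then show ?case by (intro Ck_SucI[where \<phi>'="\<lambda>x h. 0"]) (auto intro!: derivative_eq_intros)
qed simp

lemma Ck_has_derivative:
  assumes "Ck (Suc k) \<phi>"
  shows "(\<phi> has_derivative frechet_derivative \<phi> (at x)) (at x)"
  using assms by (auto simp: differentiable_on_def frechet_derivative_works)

lemma Ck_add: "Ck k \<phi> \<Longrightarrow> Ck k \<psi> \<Longrightarrow> Ck k (\<lambda>x. \<phi> x + \<psi> x)"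
proof (induction k arbitrary: \<phi> \<psi>)
  case 0
  then show ?case by (simp add: continuous_on_add)
next
  case (Suc k)
  show ?case
    by (rule Ck_SucI[where \<phi>'="\<lambda>x h. frechet_derivative \<phi> (at x) h + frechet_derivative \<psi> (at x) h"])
       (use Suc in \<open>auto intro!: has_derivative_add Ck_has_derivative\<close>)
qed

lemma Ck_mult: "Ck k \<phi> \<Longrightarrow> Ck k \<psi> \<Longrightarrow> Ck k (\<lambda>x. \<phi> x * \<psi> x)"
proof (induction k arbitrary: \<phi> \<psi>)
  case 0
  then show ?case by (simp add: continuous_on_mult)
next
  case (Suc k)
  have *: "Ck k \<phi>" "Ck k \<psi>" using Suc Ck_SucD by blast+
  show ?case
    by (rule Ck_SucI[where \<phi>'="\<lambda>x h. \<phi> x * frechet_derivative \<psi> (at x) h + frechet_derivative \<phi> (at x) h * \<psi> x"])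
       (use * Suc in \<open>auto intro!: has_derivative_mult Ck_has_derivative Ck_add\<close>)
qed

lemma Ck_prod: "finite A \<Longrightarrow> (\<And>a. a \<in> A \<Longrightarrow> Ck k (\<phi> a)) \<Longrightarrow> Ck k (\<lambda>x. \<Prod>a\<in>A. \<phi> a x)"
  by (induction A rule: finite_induct) (auto intro!: Ck_const Ck_mult)

lemma Ck_power: "Ck k \<phi> \<Longrightarrow> Ck k (\<lambda>x. \<phi> x ^ n)"
  by (induction n) (auto intro!: Ck_const Ck_mult)

text \<open>
  The family \<open>P(1/t) exp(-1/t)\<close>, extended by 0 to \<open>t \<le> 0\<close>, is closed under
  differentiation; this makes its members smooth by induction.
\<close>

definition flat_exp :: "real poly \<Rightarrow> real \<Rightarrow> real"
  where "flat_exp P t = (if t > 0 then poly P (1 / t) * exp (- (1 / t)) else 0)"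

lemma flat_exp_at_0: "(flat_exp P \<longlongrightarrow> 0) (at 0)"
proof -
  have "((\<lambda>t. poly P t / exp t) \<longlongrightarrow> 0) at_top"
  proof -
    have eq: "(\<lambda>t. poly P t / exp t) = (\<lambda>t. \<Sum>i\<le>degree P. coeff P i * (t ^ i / exp t))"
      by (simp add: poly_altdef sum_divide_distrib)
    have "((\<lambda>t. coeff P i * (t ^ i / exp t)) \<longlongrightarrow> coeff P i * 0) at_top" for i
      by (intro tendsto_intros tendsto_power_div_exp_0)
    then show ?thesis unfolding eq by (auto intro!: tendsto_null_sum)
  qed
  then have "((\<lambda>t. poly P (1 / t) * exp (- (1 / t))) \<longlongrightarrow> 0) (at_right 0)"
    by (auto dest!: filterlim_compose[OF _ filterlim_inverse_at_top_right]
        simp: exp_minus divide_inverse)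
  then have r: "(flat_exp P \<longlongrightarrow> 0) (at_right 0)"
    by (rule Lim_transform_eventually)
       (auto simp: flat_exp_def eventually_at_filter)
  have l: "(flat_exp P \<longlongrightarrow> 0) (at_left 0)"
    by (rule Lim_transform_eventually[where f="\<lambda>_. 0"])
       (auto simp: flat_exp_def eventually_at_filter)
  show ?thesis using l r by (simp add: filterlim_split_at)
qed

text \<open>With \<open>s = 1 / t\<close> one has \<open>ds/dt = - s^2\<close>, so
  \<open>P(s) exp(-s)\<close> differentiates to \<open>s^2 (P(s) - P'(s)) exp(-s)\<close>; the
  polynomial \<open>[:0, 0, 1:]\<close> is the factor \<open>s^2\<close>.\<close>

lemma flat_exp_deriv:
  "(flat_exp P has_real_derivative flat_exp ([:0, 0, 1:] * (P - pderiv P)) t) (at t)"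
proof (cases t "0::real" rule: linorder_cases)
  case less
  have "((\<lambda>_. 0) has_real_derivative 0) (at t)" by simp
  then have "(flat_exp P has_real_derivative 0) (at t)"
    by (rule has_field_derivative_transform_within_open[where S="{..<0}"])
       (use less in \<open>auto simp: flat_exp_def\<close>)
  then show ?thesis using less by (simp add: flat_exp_def)
next
  case greater
  have "((\<lambda>t. poly P (1 / t) * exp (- (1 / t))) has_real_derivative
      flat_exp ([:0, 0, 1:] * (P - pderiv P)) t) (at t)"
    using greater
    by (auto intro!: derivative_eq_intros DERIV_chain'[OF _ poly_DERIV]
        simp: flat_exp_def field_simps power2_eq_square)
  then show ?thesis
    by (rule has_field_derivative_transform_within_open[where S="{0<..}"])
       (use greater in \<open>auto simp: flat_exp_def\<close>)
next
  case equal
  \<comment> \<open>Dividing by \<open>h\<close> multiplies the polynomial in \<open>1 / h\<close>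
    by its variable, so the difference quotient at 0 is again a member of the family.\<close>
  have "((\<lambda>h. flat_exp ([:0, 1:] * P) h) \<longlongrightarrow> 0) (at 0)"
    by (rule flat_exp_at_0)
  then have "((\<lambda>h. (flat_exp P (0 + h) - flat_exp P 0) / h) \<longlongrightarrow> 0) (at 0)"
    by (rule Lim_transform_eventually)
       (auto simp: flat_exp_def eventually_at_filter)
  then show ?thesis
    using equal by (simp add: DERIV_def flat_exp_def)
qed

text \<open>\<open>P\<close> varies in the induction because each derivative changes it. The values
  1 and -1 of \<open>s\<close> give the two opposite faces of a box.\<close>

lemma Ck_flat_exp_affine: "Ck k (\<lambda>x. flat_exp P (s * (x \<bullet> b) + c))"
proof (induction k arbitrary: P)
  case 0
  have "continuous_on UNIV (flat_exp P)"
    using flat_exp_deriv by (meson DERIV_isCont continuous_at_imp_continuous_on)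
  then show ?case
    by (auto intro!: continuous_intros continuous_on_compose2[of UNIV "flat_exp P"])
next
  case (Suc k)
  let ?Q = "[:0, 0, 1:] * (P - pderiv P)"
  show ?case
  proof (rule Ck_SucI)
    fix x
    have "((\<lambda>x. s * (x \<bullet> b) + c) has_derivative (\<lambda>h. s * (h \<bullet> b))) (at x)"
      by (auto intro!: derivative_eq_intros)
    from has_derivative_compose[OF this flat_exp_deriv[of P, unfolded has_field_derivative_def]]
    show "((\<lambda>x. flat_exp P (s * (x \<bullet> b) + c)) has_derivative
      (\<lambda>h. flat_exp ?Q (s * (x \<bullet> b) + c) * (s * (h \<bullet> b)))) (at x)" .
  qed (intro Ck_mult Ck_const Suc)
qed

text \<open>Its two uses ask for positivity exactly on the open box and values below 1: powers of
  \<open>1 - box_bump l u\<close> then tend to 0 on the box, and as a cutoff it is only compared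
  with a positive lower bound near a point.\<close>

definition box_bump :: "'a::euclidean_space \<Rightarrow> 'a \<Rightarrow> 'a \<Rightarrow> real"
  where "box_bump l u x =
    (\<Prod>b\<in>Basis. flat_exp 1 (x \<bullet> b - l \<bullet> b) * flat_exp 1 (u \<bullet> b - x \<bullet> b))"

lemma flat_exp_1: "0 \<le> flat_exp 1 t" "flat_exp 1 t < 1" "flat_exp 1 t > 0 \<longleftrightarrow> t > 0"
  by (auto simp: flat_exp_def)

lemma Ck_box_bump: "Ck k (box_bump l u)"
proof -
  have "Ck k (\<lambda>x. flat_exp 1 (x \<bullet> b - l \<bullet> b))" for b
    using Ck_flat_exp_affine[of k 1 1 b "- (l \<bullet> b)"] by simp
  moreover have "Ck k (\<lambda>x. flat_exp 1 (u \<bullet> b - x \<bullet> b))" for b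
    using Ck_flat_exp_affine[of k 1 "-1" b "u \<bullet> b"] by (simp add: algebra_simps)
  ultimately show ?thesis
    unfolding box_bump_def[abs_def] by (intro Ck_prod Ck_mult) auto
qed

lemma box_bump_nonneg: "0 \<le> box_bump l u x"
  unfolding box_bump_def by (intro prod_nonneg mult_nonneg_nonneg flat_exp_1 ballI)

lemma box_bump_less_1: "box_bump l u x < 1"
proof -
  obtain b :: 'a where b: "b \<in> Basis" using nonempty_Basis by blast
  let ?F = "\<lambda>b. flat_exp 1 (x \<bullet> b - l \<bullet> b) * flat_exp 1 (u \<bullet> b - x \<bullet> b)"
  have lt: "?F b < 1" for b
    using mult_strict_mono'[of "flat_exp 1 (x \<bullet> b - l \<bullet> b)" 1 "flat_exp 1 (u \<bullet> b - x \<bullet> b)" 1]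
    by (simp add: flat_exp_1)
  have "box_bump l u x = ?F b * (\<Prod>b\<in>Basis - {b}. ?F b)"
    unfolding box_bump_def by (rule prod.remove) (use b in auto)
  also have "\<dots> \<le> ?F b * 1"
    by (intro mult_left_mono prod_le_1) (auto simp: flat_exp_1 intro: less_imp_le[OF lt])
  finally show ?thesis using lt[of b] by linarith
qed

lemma box_bump_pos_iff: "box_bump l u x > 0 \<longleftrightarrow> x \<in> box l u"
proof -
  have "box_bump l u x > 0 \<longleftrightarrow> (\<forall>b\<in>Basis. flat_exp 1 (x \<bullet> b - l \<bullet> b) * flat_exp 1 (u \<bullet> b - x \<bullet> b) \<noteq> 0)"
    using box_bump_nonneg[of l u x] by (auto simp: box_bump_def less_le)
  also have "\<dots> \<longleftrightarrow> x \<in> box l u"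
  proof -
    have "flat_exp 1 t \<noteq> 0 \<longleftrightarrow> 0 < t" for t by (simp add: flat_exp_def)
    then show ?thesis by (simp add: mem_box)
  qed
  finally show ?thesis .
qed

lemma box_bump_eq_0_iff: "box_bump l u x = 0 \<longleftrightarrow> x \<notin> box l u"
  using box_bump_pos_iff[of l u x] box_bump_nonneg[of l u x] by linarith

lemma test_functions_boxI:
  assumes "\<And>k. Ck k \<phi>" "\<And>x. x \<notin> box l u \<Longrightarrow> \<phi> x = 0" "cbox l u \<subseteq> U"
  shows "\<phi> \<in> test_functions U"
proof -
  have "closure {x. \<phi> x \<noteq> 0} \<subseteq> cbox l u"
    using assms(2) box_subset_cbox by (intro closure_minimal) auto
  then show ?thesis
    using assms by (auto simp: test_functions_def compact_closure intro: bounded_subset[OF bounded_box])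
qed

lemma Ck_minus_from_1: "Ck k \<phi> \<Longrightarrow> Ck k (\<lambda>x. 1 - \<phi> x)"
  using Ck_add[OF Ck_const[of k 1] Ck_mult[OF Ck_const[of k "-1"], of \<phi>]] by simp

subsection \<open>Uniqueness of weak derivatives\<close>

text \<open>The functions \<open>1 - (1 - \<theta>)^n\<close>, for a bump \<open>\<theta>\<close>, increase to the indicator of the box.\<close>

lemma integral_box_eq_0:
  fixes h :: "'a::euclidean_space \<Rightarrow> real"
  assumes int: "integrable lborel (\<lambda>x. indicator (cbox l u) x * h x)"
    and U: "cbox l u \<subseteq> U"
    and test: "\<And>\<phi>. \<phi> \<in> test_functions U \<Longrightarrow> (\<And>x. x \<notin> box l u \<Longrightarrow> \<phi> x = 0) \<Longrightarrow> (LINT x|lborel. h x * \<phi> x) = 0"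
  shows "(LINT x|lborel. indicator (box l u) x * h x) = 0"
proof -
  define \<phi> where "\<phi> n x = 1 - (1 - box_bump l u x) ^ n" for n :: nat and x
  have \<phi>0: "\<phi> n x = 0" if "x \<notin> box l u" for n x
    using that box_bump_eq_0_iff[of l u x] by (simp add: \<phi>_def)
  have \<phi>: "\<phi> n \<in> test_functions U" for n
  proof (rule test_functions_boxI)
    show "Ck k (\<phi> n)" for k
      unfolding \<phi>_def[abs_def] by (intro Ck_minus_from_1 Ck_power Ck_box_bump)
  qed (use \<phi>0 U in auto)
  have \<phi>c: "continuous_on UNIV (\<phi> n)" for n
    using \<phi>[of n] by (auto simp: test_functions_def dest: spec[of _ "0::nat"])
  then have [measurable]: "\<phi> n \<in> borel_measurable borel" for n
    using borel_measurable_continuous_onI by blast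
  \<comment> \<open>Integrability is known only on the closed box. Every \<open>\<phi> n\<close>
    vanishes off the open box, so \<open>h0\<close> can replace \<open>h\<close>, and its norm is
    the dominating function.\<close>
  define h0 where "h0 x = indicator (cbox l u) x * h x" for x
  have [measurable]: "h0 \<in> borel_measurable borel"
    using borel_measurable_integrable[OF int] by (simp add: h0_def[abs_def])
  have eq: "h x * \<phi> n x = h0 x * \<phi> n x" for n x
    using \<phi>0[of x n] box_subset_cbox[of l u] by (cases "x \<in> cbox l u") (auto simp: h0_def)
  have "(\<lambda>n. LINT x|lborel. h0 x * \<phi> n x) \<longlonglongrightarrow> (LINT x|lborel. indicator (box l u) x * h x)"
  proof (rule integral_dominated_convergence[where w="\<lambda>x. norm (h0 x)"])
    have "(\<lambda>x. indicator (box l u) x * h x) = (\<lambda>x. indicator (box l u) x * h0 x)"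
      using subsetD[OF box_subset_cbox[of l u]] by (auto simp: h0_def indicator_def)
    then show "(\<lambda>x. indicator (box l u) x * h x) \<in> borel_measurable lborel" by simp
    show "integrable lborel (\<lambda>x. norm (h0 x))" using int by (simp add: h0_def)
    show "AE x in lborel. (\<lambda>n. h0 x * \<phi> n x) \<longlonglongrightarrow> indicator (box l u) x * h x"
    proof (intro AE_I2)
      fix x
      show "(\<lambda>n. h0 x * \<phi> n x) \<longlonglongrightarrow> indicator (box l u) x * h x"
      proof (cases "x \<in> box l u")
        case True
        have "(\<lambda>n. (1 - box_bump l u x) ^ n) \<longlonglongrightarrow> 0"
          using True box_bump_pos_iff[of l u x] box_bump_less_1[of l u x]
          by (intro LIMSEQ_realpow_zero) linarith+
        then have "(\<lambda>n. h0 x * \<phi> n x) \<longlonglongrightarrow> h0 x * (1 - 0)"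
          unfolding \<phi>_def by (intro tendsto_mult tendsto_diff tendsto_const)
        then show ?thesis using True box_subset_cbox[of l u] by (auto simp: h0_def)
      qed (simp add: \<phi>0)
    qed
    have "0 \<le> (1 - box_bump l u x) ^ n" "(1 - box_bump l u x) ^ n \<le> 1" for n x
      using box_bump_nonneg[of l u x] box_bump_less_1[of l u x] by (auto intro!: power_le_one)
    then have "\<bar>\<phi> n x\<bar> \<le> 1" for n x
      unfolding \<phi>_def by (smt (verit))
    then show "AE x in lborel. norm (h0 x * \<phi> n x) \<le> norm (h0 x)" for n
      by (auto simp: abs_mult mult_left_le)
  qed simp
  moreover have "(LINT x|lborel. h0 x * \<phi> n x) = 0" for n
    using test[OF \<phi> \<phi>0, of n] by (simp add: eq)
  ultimately show ?thesis by (simp add: LIMSEQ_const_iff)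
qed

text \<open>Boxes are closed under intersection and generate the Borel sets, so a Dynkin induction
  carries the vanishing over to all Borel sets. The whole space is not a box; the complement step
  takes its integral from the separate assumption \<open>UNIV\<close>.\<close>

lemma AE_0_if_box_integrals_0:
  fixes h :: "'a::euclidean_space \<Rightarrow> real"
  assumes int: "integrable lborel h"
    and UNIV: "integral\<^sup>L lborel h = 0"
    and box: "\<And>l u. (LINT x|lborel. indicator (box l u) x * h x) = 0"
  shows "AE x in lborel. h x = 0"
proof (rule sigma_finite_measure.density_zero[OF sigma_finite_lborel int])
  let ?G = "range (\<lambda>(l, u). box l u) :: 'a set set"
  have sets: "sigma_sets UNIV ?G = sets lborel"
    unfolding sets_lborel by (subst borel_eq_box) simp
  fix A :: "'a set"
  assume "A \<in> sets lborel"
  then have A: "A \<in> sigma_sets UNIV ?G"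
    by (simp add: sets)
  have meas: "B \<in> sets lborel" if "B \<in> sigma_sets UNIV ?G" for B :: "'a set"
    using that by (simp only: sets)
  have setint: "set_integrable lborel B h" if "B \<in> sigma_sets UNIV ?G" for B
    unfolding set_integrable_def by (rule integrable_mult_indicator[OF meas[OF that] int])
  have stable: "Int_stable ?G"
    by (auto simp: Int_stable_def box_Int_box)
  show "set_lebesgue_integral lborel A h = 0"
    using stable subset_UNIV[of ?G, unfolded Pow_UNIV[symmetric]] A
  proof (induction A rule: sigma_sets_induct_disjoint)
    case (compl A)
    have "set_lebesgue_integral lborel (A \<union> (UNIV - A)) h
        = set_lebesgue_integral lborel A h + set_lebesgue_integral lborel (UNIV - A) h"
      using compl sigma_sets.Compl[of A UNIV] by (intro set_integral_Un) (auto intro: setint)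
    moreover have "set_lebesgue_integral lborel (A \<union> (UNIV - A)) h = 0"
      using UNIV by (simp add: set_lebesgue_integral_def)
    ultimately show ?case using compl by simp
  next
    case (union A)
    have "(\<Union>i. A i) \<in> sigma_sets UNIV (range (\<lambda>(l, u). box l u))"
      using union by (intro sigma_sets.Union) auto
    then have "set_lebesgue_integral lborel (\<Union>i. A i) h = (\<Sum>i. set_lebesgue_integral lborel (A i) h)"
      using union by (intro lebesgue_integral_countable_add setint meas)
         (auto simp: disjoint_family_on_def)
    then show ?case using union by simp
  qed (use box in \<open>auto simp: set_lebesgue_integral_def\<close>)
qed

text \<open>Cut down to a box whose closure lies in \<open>U\<close>, \<open>h\<close> becomes
  integrable with vanishing integral over every box. By Lindelof countably many such boxes cover
  \<open>U\<close>, so the exceptional null sets can be collected.\<close>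

lemma AE_0_if_test_integrals_0:
  fixes h :: "'a::euclidean_space \<Rightarrow> real"
  assumes "open U"
    and int: "\<And>l u. cbox l u \<subseteq> U \<Longrightarrow> integrable lborel (\<lambda>x. indicator (cbox l u) x * h x)"
    and test: "\<And>\<phi>. \<phi> \<in> test_functions U \<Longrightarrow> (LINT x|lborel. h x * \<phi> x) = 0"
  shows "AE x in lborel. x \<in> U \<longrightarrow> h x = 0"
proof -
  have loc: "AE x in lborel. x \<in> box l u \<longrightarrow> h x = 0" if lu: "cbox l u \<subseteq> U" for l u
  proof -
    let ?h = "\<lambda>x. indicator (box l u) x * h x"
    have zero: "(LINT x|lborel. indicator (box l' u') x * h x) = 0" if "cbox l' u' \<subseteq> U" for l' u'
      using integral_box_eq_0[OF int[OF that] that] test by blast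
    have eq: "?h = (\<lambda>x. indicator (box l u) x *\<^sub>R (indicator (cbox l u) x * h x))"
      using subsetD[OF box_subset_cbox[of l u]] by (auto simp: indicator_def fun_eq_iff)
    have "AE x in lborel. ?h x = 0"
    proof (rule AE_0_if_box_integrals_0)
      show "integrable lborel ?h"
        unfolding eq by (rule integrable_mult_indicator) (use int[OF lu] in auto)
      show "integral\<^sup>L lborel ?h = 0" by (rule zero[OF lu])
      fix l' u' :: 'a
      obtain l'' u'' :: 'a where b: "box l u \<inter> box l' u' = box l'' u''"
        using box_Int_box by blast
      have eq: "indicator (box l' u') x * ?h x = indicator (box l'' u'') x * h x" for x
        using b by (auto simp: indicator_def)
      show "(LINT x|lborel. indicator (box l' u') x * ?h x) = 0"
      proof (cases "box l'' u'' = {}")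
        case True
        then show ?thesis by (simp add: eq)
      next
        case False
        \<comment> \<open>The closed box is the closure of the open one only when the latter is
          nonempty, hence the case distinctions.\<close>
        then have "cbox l'' u'' \<subseteq> cbox l u"
          using b closure_mono[of "box l'' u''" "box l u"] closure_box[of l u] closure_box[of l'' u'']
          by (cases "box l u = {}") auto
        then show ?thesis unfolding eq using zero lu by blast
      qed
    qed
    then show ?thesis by (auto elim!: eventually_mono)
  qed
  define \<F> where "\<F> = {box l u | l u. cbox l u \<subseteq> U}"
  have "\<exists>S\<in>\<F>. x \<in> S" if x: "x \<in> U" for x
  proof -
    obtain l u where "cbox l u \<subseteq> U" "x \<in> box l u"
      by (rule open_contains_cbox[OF \<open>open U\<close> x])
    then show ?thesis unfolding \<F>_def by blast
  qed
  then have U: "U \<subseteq> \<Union>\<F>" by auto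
  obtain \<D> where D: "\<D> \<subseteq> \<F>" "countable \<D>" "\<Union>\<D> = \<Union>\<F>"
    using Lindelof[of \<F>] unfolding \<F>_def by (smt (verit) mem_Collect_eq open_box)
  have "AE x in lborel. \<forall>S\<in>\<D>. x \<in> S \<longrightarrow> h x = 0"
    using D loc by (subst AE_ball_countable) (auto simp: \<F>_def)
  then show ?thesis
    by eventually_elim (use D U in auto)
qed

subsection \<open>Integration by parts\<close>

lemma has_vector_derivative_diff_quotient:
  assumes "(F has_vector_derivative D) (at x)"
  shows "((\<lambda>h. (1 / h) *\<^sub>R (F (x + h) - F x)) \<longlongrightarrow> D) (at 0)"
proof -
  have "((\<lambda>h. norm (F (x + h) - F x - h *\<^sub>R D) / norm h) \<longlongrightarrow> 0) (at 0)"
    using assms by (simp add: has_vector_derivative_def has_derivative_at)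
  then have "((\<lambda>h. norm ((1 / h) *\<^sub>R (F (x + h) - F x) - D)) \<longlongrightarrow> 0) (at 0)"
  proof (rule Lim_transform_eventually)
    have "norm (F (x + h) - F x - h *\<^sub>R D) / norm h = norm ((1 / h) *\<^sub>R (F (x + h) - F x) - D)"
      if "h \<noteq> 0" for h
    proof -
      have "(1 / h) *\<^sub>R (F (x + h) - F x) - D = (1 / h) *\<^sub>R (F (x + h) - F x - h *\<^sub>R D)"
        using that by (simp add: scaleR_diff_right)
      then show ?thesis by simp
    qed
    then show "\<forall>\<^sub>F h in at 0. norm (F (x + h) - F x - h *\<^sub>R D) / norm h
        = norm ((1 / h) *\<^sub>R (F (x + h) - F x) - D)"
      by (simp add: eventually_at_filter)
  qed
  then show ?thesis
    by (simp add: tendsto_norm_zero_iff LIM_zero_iff)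
qed

lemma integral_lborel_translate:
  fixes F :: "'a::euclidean_space \<Rightarrow> 'b::{banach, second_countable_topology}"
  assumes "F \<in> borel_measurable borel"
  shows "(LINT x|lborel. F (x + a)) = integral\<^sup>L lborel F"
proof -
  have "integral\<^sup>L lborel F = integral\<^sup>L (distr lborel borel ((+) a)) F"
    by (simp add: lborel_distr_plus)
  also have "\<dots> = (LINT x|lborel. F (x + a))"
    by (subst integral_distr) (use assms in \<open>auto simp: add.commute\<close>)
  finally show ?thesis by simp
qed

text \<open>
  The difference quotients have integral zero by translation invariance, so no Fubini argument
  and no continuity of \<open>F'\<close> is needed.
\<close>

lemma integral_directional_derivative_eq_0:
  fixes F F' :: "'a::euclidean_space \<Rightarrow> 'b::{banach, second_countable_topology}"
  assumes meas: "F \<in> borel_measurable borel"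
    and K: "compact K" "\<And>x. x \<notin> K \<Longrightarrow> F x = 0"
    and deriv: "\<And>x. ((\<lambda>t. F (x + t *\<^sub>R b)) has_vector_derivative F' x) (at 0)"
    and bound: "bounded (range F)" "bounded (range F')"
  shows "integrable lborel F'" "integral\<^sup>L lborel F' = 0"
proof -
  obtain A where A: "\<And>x. norm (F x) \<le> A" using bound(1) by (auto simp: bounded_iff)
  obtain B where B: "\<And>x. norm (F' x) \<le> B" using bound(2) by (auto simp: bounded_iff)
  define D where "D n x = real (Suc n) *\<^sub>R (F (x + (1 / real (Suc n)) *\<^sub>R b) - F x)" for n x
  \<comment> \<open>The difference quotients use steps in (0, 1]. Sweeping \<open>K\<close>
    backwards along \<open>b\<close> for such times gives one compact set outside which all of them
    vanish.\<close>
  define L where "L = (\<lambda>(x, t). x - t *\<^sub>R b) ` (K \<times> {0..1})"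
  have L: "compact L"
    unfolding L_def case_prod_unfold
    by (intro compact_continuous_image continuous_intros compact_Times K compact_Icc)
  have inL: "x \<in> L" if "x + t *\<^sub>R b \<in> K" "t \<in> {0..1}" for x t
    unfolding L_def by (rule image_eqI[where x="(x + t *\<^sub>R b, t)"]) (use that in auto)
  have deriv': "((\<lambda>t. F (x + t *\<^sub>R b)) has_vector_derivative F' (x + t *\<^sub>R b)) (at t)" for x t
  proof -
    have "((\<lambda>s. s - t) has_derivative (\<lambda>h. h)) (at t)"
      by (auto intro!: derivative_eq_intros)
    moreover have "((\<lambda>s. F ((x + t *\<^sub>R b) + s *\<^sub>R b)) has_derivative (\<lambda>h. h *\<^sub>R F' (x + t *\<^sub>R b))) (at (t - t))"
      using deriv[of "x + t *\<^sub>R b"] by (simp add: has_vector_derivative_def)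
    ultimately have "((\<lambda>s. F ((x + t *\<^sub>R b) + (s - t) *\<^sub>R b)) has_derivative (\<lambda>h. h *\<^sub>R F' (x + t *\<^sub>R b))) (at t)"
      by (rule has_derivative_compose)
    then show ?thesis by (simp add: has_vector_derivative_def algebra_simps)
  qed
  \<comment> \<open>By the mean value inequality along the line, the bound on \<open>F'\<close>
    bounds all difference quotients uniformly.\<close>
  have lip: "norm (F (x + t *\<^sub>R b) - F (x + 0 *\<^sub>R b)) \<le> B * norm (t - 0)" for x t
  proof (rule differentiable_bound[where S=UNIV])
    show "((\<lambda>t. F (x + t *\<^sub>R b)) has_derivative (\<lambda>h. h *\<^sub>R F' (x + s *\<^sub>R b))) (at s within UNIV)" for s
      using deriv'[of x s] by (simp add: has_vector_derivative_def)
    show "onorm (\<lambda>h. h *\<^sub>R F' (x + s *\<^sub>R b)) \<le> B" for s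
      using B[of "x + s *\<^sub>R b"] order_trans[OF norm_ge_zero B]
      by (intro onorm_bound) (auto simp: mult.commute[of "B"] mult_left_mono)
  qed auto
  have DB: "norm (D n x) \<le> indicator L x * B" for n x
  proof (cases "x \<in> L")
    case True
    have "norm (D n x) \<le> real (Suc n) * (B * (1 / real (Suc n)))"
      using lip[of x "1 / real (Suc n)"] unfolding D_def norm_scaleR
      by (intro mult_mono) auto
    then show ?thesis using True by simp
  next
    case False
    then have "x + (1 / real (Suc n)) *\<^sub>R b \<notin> K" "x \<notin> K"
      using inL[of x "1 / real (Suc n)"] inL[of x 0] by auto
    then show ?thesis using K False by (simp add: D_def)
  qed
  have lim: "(\<lambda>n. D n x) \<longlonglongrightarrow> F' x" for x
  proof -
    have "((\<lambda>h. (1 / h) *\<^sub>R (F (x + (0 + h) *\<^sub>R b) - F (x + 0 *\<^sub>R b))) \<longlongrightarrow> F' x) (at 0)"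
      by (rule has_vector_derivative_diff_quotient[OF deriv])
    moreover have "filterlim (\<lambda>n. 1 / real (Suc n)) (at 0) sequentially"
      unfolding filterlim_at using LIMSEQ_inverse_real_of_nat by (auto simp: inverse_eq_divide)
    ultimately have "(\<lambda>n. (1 / (1 / real (Suc n))) *\<^sub>R (F (x + (0 + 1 / real (Suc n)) *\<^sub>R b) - F (x + 0 *\<^sub>R b)))
        \<longlonglongrightarrow> F' x"
      by (rule filterlim_compose)
    then show ?thesis by (simp add: D_def)
  qed
  have [measurable]: "F \<in> borel_measurable borel" by fact
  have Dm[measurable]: "D n \<in> borel_measurable borel" for n
    unfolding D_def[abs_def]
    by (intro borel_measurable_scaleR borel_measurable_diff borel_measurable_const meas
        measurable_compose[OF _ meas]) simp
  have [measurable]: "F' \<in> borel_measurable borel"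
    by (rule borel_measurable_LIMSEQ_metric[OF Dm lim])
  have [measurable]: "L \<in> sets borel" "K \<in> sets borel"
    using L K by (auto intro: borel_compact)
  have iL: "integrable lborel (\<lambda>x. indicator L x * B)"
    using L by (intro integrable_mult_left) (auto intro: emeasure_compact_finite)
  have "norm (F x) \<le> indicator K x * A" for x
    using A[of x] K(2)[of x] by (cases "x \<in> K") auto
  then have F: "integrable lborel F"
  proof (intro Bochner_Integration.integrable_bound[of _ "\<lambda>x. indicator K x * A" F])
    show "integrable lborel (\<lambda>x. indicator K x * A)"
      using K by (intro integrable_mult_left) (auto intro: emeasure_compact_finite)
  qed (use \<open>\<And>x. norm (F x) \<le> indicator K x * A\<close> in \<open>auto intro!: AE_I2 order_trans[OF _ abs_ge_self]\<close>)
  have D0: "integral\<^sup>L lborel (D n) = 0" for n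
  proof -
    define a where "a = (1 / real (Suc n)) *\<^sub>R b"
    have "integrable lborel (\<lambda>x. F (x + a))"
    proof -
      have "integrable (distr lborel borel ((+) a)) F" using F by (simp add: lborel_distr_plus)
      then show ?thesis by (subst (asm) integrable_distr_eq) (auto simp: add.commute)
    qed
    then have "integral\<^sup>L lborel (D n) = real (Suc n) *\<^sub>R ((LINT x|lborel. F (x + a)) - integral\<^sup>L lborel F)"
      unfolding D_def a_def[symmetric] using F by simp
    then show ?thesis by (simp add: integral_lborel_translate[OF meas])
  qed
  have "integrable lborel F' \<and> (\<lambda>n. integral\<^sup>L lborel (D n)) \<longlonglongrightarrow> integral\<^sup>L lborel F'"
    using lim DB by (intro conjI integrable_dominated_convergence[OF _ _ iL, of F' D]
      integral_dominated_convergence[OF _ _ iL, of F' D]) auto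
  then show "integrable lborel F'" "integral\<^sup>L lborel F' = 0"
    by (auto simp: D0 LIMSEQ_const_iff)
qed

subsection \<open>Partial derivatives of holomorphic functions\<close>

lemma axis_simps:
  "axis i (a + b) = axis i a + axis i (b::complex)"
  "axis i (a - b) = axis i a - axis i (b::complex)"
  "axis i (c * a) = c *s axis i (a::complex)"
  "axis i (t *\<^sub>R a) = t *\<^sub>R axis i (a::complex)"
  "axis i (0::complex) = 0"
  by (auto simp: axis_def vec_eq_iff)

lemma norm_vector_smult: "norm (c *s w) = norm c * norm (w :: complex ^ 'n)"
  unfolding norm_vec_def by (simp add: norm_mult L2_set_right_distrib)

lemma norm_axis: "norm (axis i (a::complex)) = norm a"
  by (simp add: norm_eq_sqrt_inner inner_axis')

text \<open>Complex linearity of the derivative \<open>D\<close> turns the chain rule along the line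
  into multiplication by the number \<open>D w\<close>, that is, into a complex derivative.\<close>

lemma holomorphic_vec_line_deriv:
  assumes "open U" "holomorphic_vec_on f U" "z + t *s w \<in> U"
  shows "((\<lambda>t. f (z + t *s w)) has_field_derivative frechet_derivative f (at (z + t *s w)) w) (at t)"
proof -
  obtain D where D: "(f has_derivative D) (at (z + t *s w))" "\<And>c w. D (c *s w) = c * D w"
    using assms(2,3) at_within_open[OF assms(3,1)] unfolding holomorphic_vec_on_def by metis
  have "bounded_linear (\<lambda>t. t *s w)"
    by (rule bounded_linear_intro[where K="norm w"])
      (auto simp: vec_eq_iff algebra_simps norm_vector_smult)
  then have "((\<lambda>t. z + t *s w) has_derivative (\<lambda>h. h *s w)) (at t)"
    by (auto intro!: derivative_eq_intros bounded_linear_imp_has_derivative)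
  from has_derivative_compose[OF this D(1)]
  have "((\<lambda>t. f (z + t *s w)) has_derivative (\<lambda>h. D (h *s w))) (at t)" .
  moreover have "(\<lambda>h. D (h *s w)) = (*) (D w)"
    using D(2) by (auto simp: mult.commute)
  moreover have "frechet_derivative f (at (z + t *s w)) = D"
    using frechet_derivative_at[OF D(1)] by simp
  ultimately show ?thesis
    unfolding has_field_derivative_def by (simp only:)
qed

text \<open>Extending \<open>f\<close> by 0 gives a Borel function on the whole space with the same
  bound, so all integrals can be taken over \<open>lborel\<close>. The functions \<open>v\<close>,
  \<open>Q\<close> and \<open>G\<close> built from it then vanish outside \<open>U\<close>.\<close>

locale holomorphic_direction =
  fixes U :: "(complex ^ 'n) set" and f :: "complex ^ 'n \<Rightarrow> complex" and i :: 'n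
  assumes open_U: "open U"
    and hol: "holomorphic_vec_on f U"
    and less: "\<And>z. cmod (f z) < 1 / 2"
    and outside: "\<And>z. z \<notin> U \<Longrightarrow> f z = 0"
begin

definition g :: "complex ^ 'n \<Rightarrow> complex"
  where "g z = (if z \<in> U then frechet_derivative f (at z) (axis i 1) else 0)"

definition g2 :: "complex ^ 'n \<Rightarrow> complex"
  where "g2 z = deriv (\<lambda>t. g (z + axis i t)) 0"

lemma slice_deriv:
  assumes "z + axis i t \<in> U"
  shows "((\<lambda>t. f (z + axis i t)) has_field_derivative g (z + axis i t)) (at t)"
proof -
  define e :: "complex ^ 'n" where "e = axis i 1"
  have axis: "axis i t = t *s e" for t
    using axis_simps(3)[of i t 1] by (simp only: mult_1_right e_def)
  show ?thesis
    using holomorphic_vec_line_deriv[OF open_U hol, of z t e] assms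
    by (simp only: g_def if_True axis) (simp add: e_def)
qed

lemma in_U_if_cball: "cball z r \<subseteq> U \<Longrightarrow> cmod t \<le> r \<Longrightarrow> z + axis i t \<in> U"
  by (auto simp: dist_norm norm_axis subset_iff)

lemma slice_holomorphic:
  assumes "cball z r \<subseteq> U"
  shows "(\<lambda>t. f (z + axis i t)) holomorphic_on cball 0 r"
  unfolding holomorphic_on_def field_differentiable_def
  using slice_deriv[OF in_U_if_cball[OF assms]] has_field_derivative_at_within by fastforce

lemma deriv_slice_eq:
  assumes "cball z r \<subseteq> U" "cmod t \<le> r"
  shows "deriv (\<lambda>t. f (z + axis i t)) t = g (z + axis i t)"
  by (intro DERIV_imp_deriv slice_deriv in_U_if_cball[OF assms])

text \<open>On a disc around 0 the slice of \<open>g\<close> is the derivative of the holomorphic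
  slice of \<open>f\<close>, hence holomorphic itself.\<close>

lemma g_slice_deriv:
  assumes "z \<in> U"
  shows "((\<lambda>t. g (z + axis i t)) has_field_derivative g2 z) (at 0)"
proof -
  obtain r where r: "r > 0" "cball z r \<subseteq> U"
    using open_U assms by (auto simp: open_contains_cball)
  have "(\<lambda>t. f (z + axis i t)) holomorphic_on ball 0 r"
    using slice_holomorphic[OF r(2)] by (rule holomorphic_on_subset) auto
  then have "deriv (\<lambda>t. f (z + axis i t)) holomorphic_on ball 0 r"
    by (rule holomorphic_deriv) auto
  then have "(\<lambda>t. g (z + axis i t)) holomorphic_on ball 0 r"
    by (rule holomorphic_transform) (use deriv_slice_eq[OF r(2)] in auto)
  then show ?thesis
    unfolding g2_def using r by (intro holomorphic_derivI[where S="ball 0 r"]) auto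
qed

text \<open>Cauchy's inequalities on the slice through \<open>z\<close>, with the bound 1/2 on |f|
  rounded up to 1.\<close>

lemma g_bounds:
  assumes "cball z r \<subseteq> U" "r > 0"
  shows "cmod (g z) \<le> 1 / r" "cmod (g2 z) \<le> 2 / r\<^sup>2"
proof -
  let ?F = "\<lambda>t. f (z + axis i t)"
  have hol: "?F holomorphic_on ball 0 r" "continuous_on (cball 0 r) ?F"
    using slice_holomorphic[OF assms(1)]
    by (auto intro: holomorphic_on_subset holomorphic_on_imp_continuous_on)
  have le: "cmod ((deriv ^^ n) ?F 0) \<le> fact n * 1 / r ^ n" for n
    using hol assms(2) by (rule Cauchy_inequality) (use less less_imp_le[of _ 1] in \<open>smt (verit) field_sum_of_halves\<close>)
  have "deriv ?F 0 = g z"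
    using deriv_slice_eq[OF assms(1), of 0] assms by (simp add: axis_simps)
  then show "cmod (g z) \<le> 1 / r" using le[of 1] by simp
  have "deriv (deriv ?F) 0 = deriv (\<lambda>t. g (z + axis i t)) 0"
  proof (rule deriv_cong_ev)
    have "\<forall>\<^sub>F t in nhds 0. t \<in> ball 0 r"
      using assms by (intro eventually_nhds_in_open) auto
    then show "\<forall>\<^sub>F t in nhds 0. deriv ?F t = g (z + axis i t)"
      by eventually_elim (use deriv_slice_eq[OF assms(1)] in auto)
  qed simp
  then show "cmod (g2 z) \<le> 2 / r\<^sup>2"
    using le[of 2] by (simp add: g2_def numeral_2_eq_2)
qed

text \<open>A compact subset keeps a positive distance from the complement of \<open>U\<close>, so
  the Cauchy estimates apply with one radius at all its points.\<close>

lemma g_bounded_on_compact: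
  assumes "compact S" "S \<subseteq> U"
  shows "bounded (g ` S)" "bounded (g2 ` S)"
proof -
  obtain r where r: "r > 0" "\<And>z. z \<in> S \<Longrightarrow> cball z r \<subseteq> U"
    using compact_subset_open_imp_cball_epsilon_subset[OF assms(1) open_U assms(2)] 
    by (metis (no_types, lifting) UN_subset_iff)
  then show "bounded (g ` S)" "bounded (g2 ` S)"
    using g_bounds by (auto simp: bounded_iff) blast+
qed

lemma continuous_f: "continuous_on U f"
  using hol unfolding holomorphic_vec_on_def continuous_on_eq_continuous_within
  by (meson has_derivative_continuous)

lemma f_measurable [measurable]: "f \<in> borel_measurable borel"
proof -
  have "(\<lambda>z. if z \<in> U then f z else 0) \<in> borel_measurable borel"
    using open_U by (intro borel_measurable_continuous_on_if continuous_f) auto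
  also have "(\<lambda>z. if z \<in> U then f z else 0) = f" using outside by auto
  finally show ?thesis .
qed

lemma vector_derivative_if_slice:
  fixes h :: "complex ^ 'n \<Rightarrow> complex"
  assumes "((\<lambda>t. h (z + axis i t)) has_field_derivative d) (at 0)"
  shows "((\<lambda>t. h (z + t *\<^sub>R axis i c)) has_vector_derivative c * d) (at 0)"
proof -
  have "((\<lambda>t. of_real t * c) has_vector_derivative c) (at 0)"
    by (auto intro!: derivative_eq_intros)
  moreover have "((\<lambda>t. h (z + axis i t)) has_field_derivative d) (at (of_real 0 * c))"
    using assms by simp
  ultimately have "((\<lambda>t. h (z + axis i t)) \<circ> (\<lambda>t. of_real t * c) has_vector_derivative c * d) (at 0)"
    by (rule field_vector_diff_chain_at)
  moreover have "axis i (of_real t * c) = t *\<^sub>R axis i c" for t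
    unfolding scaleR_conv_of_real[symmetric] by (rule axis_simps)
  ultimately show ?thesis by (simp add: o_def)
qed

lemma f_directional_derivative:
  assumes "z \<in> U"
  shows "((\<lambda>t. f (z + t *\<^sub>R axis i c)) has_vector_derivative c * g z) (at 0)"
  using slice_deriv[of z 0] assms by (intro vector_derivative_if_slice) (simp add: axis_simps)

lemma g_directional_derivative:
  assumes "z \<in> U"
  shows "((\<lambda>t. g (z + t *\<^sub>R axis i c)) has_vector_derivative c * g2 z) (at 0)"
  by (intro vector_derivative_if_slice g_slice_deriv assms)

text \<open>\<open>g\<close> is a pointwise limit of difference quotients of the Borel function
  \<open>f\<close>; the indicator reproduces its value 0 outside \<open>U\<close>.\<close>

lemma g_measurable [measurable]: "g \<in> borel_measurable borel"
proof (rule borel_measurable_LIMSEQ_metric)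
  have [measurable]: "U \<in> sets borel" using open_U by simp
  let ?D = "\<lambda>n z. indicator U z *\<^sub>R real (Suc n) *\<^sub>R (f (z + (1 / real (Suc n)) *\<^sub>R axis i 1) - f z)"
  show "?D n \<in> borel_measurable borel" for n
    by measurable
  show "(\<lambda>n. ?D n z) \<longlonglongrightarrow> g z" for z
  proof (cases "z \<in> U")
    case True
    have "((\<lambda>h. (1 / h) *\<^sub>R (f (z + (0 + h) *\<^sub>R axis i 1) - f (z + 0 *\<^sub>R axis i 1))) \<longlongrightarrow> 1 * g z) (at 0)"
      by (rule has_vector_derivative_diff_quotient[OF f_directional_derivative[OF True]])
    moreover have "filterlim (\<lambda>n. 1 / real (Suc n)) (at 0) sequentially"
      unfolding filterlim_at using LIMSEQ_inverse_real_of_nat by (auto simp: inverse_eq_divide)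
    ultimately have "(\<lambda>n. (1 / (1 / real (Suc n))) *\<^sub>R (f (z + (0 + 1 / real (Suc n)) *\<^sub>R axis i 1) - f (z + 0 *\<^sub>R axis i 1)))
        \<longlonglongrightarrow> 1 * g z"
      by (rule filterlim_compose)
    then show ?thesis using True by simp
  qed (simp add: g_def)
qed

end

lemma directional_derivative_outside:
  fixes x :: "'a::real_normed_vector"
  assumes "closed S" "x \<notin> S" "\<And>x. x \<notin> S \<Longrightarrow> F x = 0"
  shows "((\<lambda>t. F (x + t *\<^sub>R b)) has_vector_derivative 0) (at 0)"
proof -
  have "open ((\<lambda>t. x + t *\<^sub>R b) -` (- S))"
    using assms(1) by (intro open_vimage) (auto intro!: continuous_intros)
  then show ?thesis
    by (rule has_vector_derivative_transform_within_open[OF has_vector_derivative_const])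
       (use assms in auto)
qed

lemma test_function_props:
  assumes "\<phi> \<in> test_functions U"
  obtains S where "compact S" "S \<subseteq> U" "\<And>x. x \<notin> S \<Longrightarrow> \<phi> x = 0"
    "\<And>x b. x \<notin> S \<Longrightarrow> frechet_derivative \<phi> (at x) b = 0"
    "continuous_on UNIV \<phi>"
    "\<And>b. b \<in> Basis \<Longrightarrow> continuous_on UNIV (\<lambda>x. frechet_derivative \<phi> (at x) b)"
    "\<And>x b. ((\<lambda>t. \<phi> (x + t *\<^sub>R b)) has_vector_derivative frechet_derivative \<phi> (at x) b) (at 0)"
proof -
  define S where "S = closure {x. \<phi> x \<noteq> 0}"
  have S: "compact S" "S \<subseteq> U" and Ck: "\<And>k. Ck k \<phi>"
    using assms by (auto simp: test_functions_def S_def)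
  have out: "\<phi> x = 0" if "x \<notin> S" for x
    using that closure_subset[of "{x. \<phi> x \<noteq> 0}"] by (auto simp: S_def)
  have deriv: "((\<lambda>t. \<phi> (x + t *\<^sub>R b)) has_vector_derivative frechet_derivative \<phi> (at x) b) (at 0)" for x b
  proof -
    have d: "(\<phi> has_derivative frechet_derivative \<phi> (at x)) (at (x + 0 *\<^sub>R b))"
      using Ck_has_derivative[OF Ck] by simp
    have "((\<lambda>t. x + t *\<^sub>R b) has_derivative (\<lambda>h. h *\<^sub>R b)) (at 0)"
      by (auto intro!: derivative_eq_intros)
    from has_derivative_compose[OF this d]
    show ?thesis
      using linear_cmul[OF has_derivative_linear[OF d]] by (simp add: has_vector_derivative_def)
  qed
  show thesis
  proof
    show "frechet_derivative \<phi> (at x) b = 0" if "x \<notin> S" for x b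
      using vector_derivative_unique_at[OF deriv directional_derivative_outside[of S x \<phi> b]] that out
        compact_imp_closed[OF S(1)] by blast
    show "continuous_on UNIV \<phi>" using Ck[of 0] by simp
    show "continuous_on UNIV (\<lambda>x. frechet_derivative \<phi> (at x) b)" if "b \<in> Basis" for b
      using Ck[of "Suc 0"] that by simp
  qed (use S out deriv in auto)
qed

subsection \<open>A Caccioppoli estimate\<close>

lemma bounded_image_mult:
  fixes F G :: "'a \<Rightarrow> 'b::real_normed_algebra"
  assumes "bounded (F ` S)" "bounded (G ` S)"
  shows "bounded ((\<lambda>x. F x * G x) ` S)"
proof -
  obtain A B where "\<And>x. x \<in> S \<Longrightarrow> norm (F x) \<le> A" "\<And>x. x \<in> S \<Longrightarrow> norm (G x) \<le> B"
    using assms by (auto simp: bounded_iff)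
  then have "norm (F x * G x) \<le> A * B" if "x \<in> S" for x
    using that by (intro order_trans[OF norm_mult_ineq] mult_mono) (auto intro: order_trans[OF norm_ge_zero])
  then show ?thesis by (auto simp: bounded_iff)
qed

lemma bounded_image_norm_le:
  assumes "bounded (G ` S)" "\<And>x. x \<in> S \<Longrightarrow> norm (F x) \<le> norm (G x)"
  shows "bounded (F ` S)"
proof -
  obtain B where "\<And>x. x \<in> S \<Longrightarrow> norm (G x) \<le> B" using assms(1) by (auto simp: bounded_iff)
  then have "norm (F x) \<le> B" if "x \<in> S" for x using that assms(2) order_trans by blast
  then show ?thesis by (auto simp: bounded_iff)
qed

lemma bounded_range_if_0_outside:
  assumes "bounded (F ` S)" "\<And>x. x \<notin> S \<Longrightarrow> F x = 0"
  shows "bounded (range F)"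
proof -
  have "range F \<subseteq> insert 0 (F ` S)" using assms(2) by auto
  then show ?thesis using assms(1) by (metis bounded_insert bounded_subset)
qed

lemma borel_measurable_cnj: "cnj \<in> borel_measurable borel"
  by (intro borel_measurable_continuous_onI continuous_intros)

lemma axis_in_Basis: "axis i (1::complex) \<in> Basis" "axis i \<i> \<in> Basis"
  by (auto simp: Basis_vec_def Basis_complex_def)

lemma ln_le_minus_half: "0 < x \<Longrightarrow> x \<le> 1 / 2 \<Longrightarrow> ln x \<le> - (1 / 2::real)"
  using ln_le_minus_one[of x] by linarith

text \<open>
  Here \<open>D c d\<close> is the derivative, in the direction \<open>c\<close> of the complex line, of
  \<open>\<eta>\<^sup>2 K cnj f g\<close>, where \<open>g = f'\<close>, \<open>g2 = f''\<close>, \<open>M = 4 - ln X\<close> and \<open>d\<close> is the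
  derivative of \<open>\<eta>\<close>. In the combination \<open>D 1 + \<i> D \<i>\<close>, which is \<open>2 \<partial>/\<partial>cnj z\<close>, the second
  derivative of \<open>f\<close> cancels.
\<close>

lemma caccioppoli_pointwise:
  fixes f g g2 :: complex and e \<eta> \<eta>1 \<eta>2 X M K :: real
  defines "X \<equiv> (cmod f)\<^sup>2 + e" 
  defines "K \<equiv> 1 / (X * M)"
  defines "D \<equiv> \<lambda>c d. of_real (2 * \<eta> * d * K - \<eta>\<^sup>2 * (2 * Re (cnj f * (c * g)) * (M - 1) * K\<^sup>2)) * (cnj f * g)
      + of_real (\<eta>\<^sup>2 * K) * (cnj (c * g) * g + cnj f * (c * g2))"
  assumes e: "e > 0" and M: "M \<ge> 4"
  shows "\<eta>\<^sup>2 * (cmod g)\<^sup>2 / (X * M\<^sup>2) \<le> Re (D 1 \<eta>1 + \<i> * D \<i> \<eta>2) + (\<bar>\<eta>1\<bar> + \<bar>\<eta>2\<bar>)\<^sup>2"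
proof -
  define R where "R = Re (cnj f * g)"
  define I where "I = Im (cnj f * g)"
  define s where "s = (cmod f)\<^sup>2"
  have s: "s \<ge> 0" "X = s + e" by (auto simp: s_def X_def)
  have X: "X > 0" using s e by linarith
  have K: "K > 0" "K * (X * M) = 1" using X M by (auto simp: K_def)
  have RI: "R\<^sup>2 + I\<^sup>2 = s * (cmod g)\<^sup>2"
  proof -
    have "R\<^sup>2 + I\<^sup>2 = (cmod (cnj f * g))\<^sup>2" by (simp add: R_def I_def cmod_power2)
    then show ?thesis by (simp add: norm_mult power_mult_distrib s_def)
  qed
  have gg: "Re (cnj g * g) = (cmod g)\<^sup>2" unfolding cmod_power2 by (simp add: power2_eq_square)
  \<comment> \<open>Direction \<open>\<i>\<close> contributes the imaginary part through
    \<open>Re (cnj f * (\<i> * g)) = - I\<close>. The terms with \<open>cnj (c * g) * g\<close> add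
    up because \<open>\<i> * cnj \<i> = 1\<close>, while those with \<open>g2\<close> carry the
    factors 1 and \<open>\<i> * \<i>\<close>.\<close>
  have "Re (D 1 \<eta>1 + \<i> * D \<i> \<eta>2) = 2 * \<eta> * K * (\<eta>1 * R - \<eta>2 * I)
      - 2 * \<eta>\<^sup>2 * (M - 1) * K\<^sup>2 * (R\<^sup>2 + I\<^sup>2) + 2 * \<eta>\<^sup>2 * K * Re (cnj g * g)"
    unfolding D_def R_def I_def by (simp add: algebra_simps power2_eq_square)
  also have "\<dots> = 2 * \<eta> * K * (\<eta>1 * R - \<eta>2 * I) + 2 * (\<eta>\<^sup>2 * (cmod g)\<^sup>2) * (K - (M - 1) * K\<^sup>2 * s)"
    unfolding RI gg by (simp add: algebra_simps)
  finally have Re: "Re (D 1 \<eta>1 + \<i> * D \<i> \<eta>2) = \<dots>" .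
  \<comment> \<open>Times \<open>(cmod g)\<^sup>2\<close>, the quantity
    \<open>K - (M - 1) * K\<^sup>2 * s\<close> is the mixed second derivative of
    \<open>- ln M\<close>. Expanding \<open>K\<close> makes its positivity visible.\<close>
  have "K = K * (K * (X * M))" by (simp add: K)
  then have "K - (M - 1) * K\<^sup>2 * s = K\<^sup>2 * (s + e * M)"
    by (simp add: s algebra_simps power2_eq_square)
  also have "\<dots> \<ge> K\<^sup>2 * X"
    using e M by (intro mult_left_mono) (auto simp: s)
  finally have 1: "K\<^sup>2 * X \<le> K - (M - 1) * K\<^sup>2 * s" .
  \<comment> \<open>\<open>P\<^sup>2\<close> is the left-hand side of the claim. The second-order
    term contributes at least \<open>2 * P\<^sup>2\<close> and the cutoff term at least
    \<open>- 2 * P * A\<close>; since \<open>2 * P * A \<le> P\<^sup>2 + A\<^sup>2\<close>, one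
    \<open>P\<^sup>2\<close> remains.\<close>
  define P where "P = \<bar>\<eta>\<bar> * cmod g * K * sqrt X"
  define A where "A = \<bar>\<eta>1\<bar> + \<bar>\<eta>2\<bar>"
  have P2: "P\<^sup>2 = \<eta>\<^sup>2 * (cmod g)\<^sup>2 * (K\<^sup>2 * X)"
    using X by (simp add: P_def power_mult_distrib)
  have "\<bar>\<eta> * K * (\<eta>1 * R - \<eta>2 * I)\<bar> \<le> P * A"
  proof -
    have RI_le: "\<bar>R\<bar> \<le> cmod f * cmod g" "\<bar>I\<bar> \<le> cmod f * cmod g"
      unfolding R_def I_def
      by (metis abs_Re_le_cmod complex_mod_cnj norm_mult, metis abs_Im_le_cmod complex_mod_cnj norm_mult)
    have fX: "cmod f \<le> sqrt X"
      using e by (intro real_le_rsqrt) (simp add: X_def)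
    have "\<bar>\<eta>1 * R - \<eta>2 * I\<bar> \<le> \<bar>\<eta>1\<bar> * \<bar>R\<bar> + \<bar>\<eta>2\<bar> * \<bar>I\<bar>"
      by (metis abs_mult abs_triangle_ineq4)
    also have "\<dots> \<le> A * (cmod f * cmod g)"
      unfolding A_def distrib_right using RI_le by (intro add_mono mult_left_mono) auto
    also have "\<dots> \<le> A * (sqrt X * cmod g)"
      using fX by (intro mult_left_mono mult_right_mono) (auto simp: A_def)
    finally have "\<bar>\<eta>\<bar> * K * \<bar>\<eta>1 * R - \<eta>2 * I\<bar> \<le> \<bar>\<eta>\<bar> * K * (A * (sqrt X * cmod g))"
      using K by (intro mult_left_mono) auto
    then show ?thesis using K by (simp add: P_def abs_mult mult_ac)
  qed
  moreover have "2 * P * A \<le> P\<^sup>2 + A\<^sup>2" by (rule sum_squares_bound)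
  moreover have "2 * (\<eta>\<^sup>2 * (cmod g)\<^sup>2) * (K\<^sup>2 * X) \<le> 2 * (\<eta>\<^sup>2 * (cmod g)\<^sup>2) * (K - (M - 1) * K\<^sup>2 * s)"
    using 1 by (intro mult_left_mono) auto
  moreover have "\<eta>\<^sup>2 * (cmod g)\<^sup>2 / (X * M\<^sup>2) = P\<^sup>2"
    unfolding P2 K_def using X M by (simp add: field_simps power2_eq_square)
  ultimately show ?thesis unfolding Re P2 A_def by linarith
qed

context holomorphic_direction
begin

definition X :: "real \<Rightarrow> complex ^ 'n \<Rightarrow> real"
  where "X e z = (cmod (f z))\<^sup>2 + e"

definition K :: "real \<Rightarrow> complex ^ 'n \<Rightarrow> real"
  where "K e z = 1 / (X e z * (4 - ln (X e z)))"

text \<open>The cap 1/4 on \<open>e\<close> together with |f|^2 < 1/4 keeps \<open>X\<close> at most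
  1/2, so its logarithm stays away from 0.\<close>

lemma X_bounds:
  assumes "0 < e" "e \<le> 1 / 4"
  shows "e \<le> X e z" "0 < X e z" "X e z \<le> 1 / 2" "ln (X e z) \<le> - (1 / 2)"
proof -
  have "(cmod (f z))\<^sup>2 \<le> (1 / 2)\<^sup>2" using less[of z] by (intro power_mono) auto
  then show *: "e \<le> X e z" "0 < X e z" "X e z \<le> 1 / 2"
    using assms by (auto simp: X_def power2_eq_square intro: add_nonneg_pos)
  show "ln (X e z) \<le> - (1 / 2)" using * by (intro ln_le_minus_half)
qed

lemma X_directional_derivative:
  assumes "z \<in> U"
  shows "((\<lambda>t. X e (z + t *\<^sub>R axis i c)) has_real_derivative 2 * Re (cnj (f z) * (c * g z))) (at 0)"
proof -
  note f' = f_directional_derivative[OF assms, of c]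
  have "((\<lambda>t. Re (f (z + t *\<^sub>R axis i c))) has_real_derivative Re (c * g z)) (at 0)"
    "((\<lambda>t. Im (f (z + t *\<^sub>R axis i c))) has_real_derivative Im (c * g z)) (at 0)"
    using bounded_linear.has_vector_derivative[OF bounded_linear_Re f']
      bounded_linear.has_vector_derivative[OF bounded_linear_Im f']
    by (auto simp: has_real_derivative_iff_has_vector_derivative)
  then have "((\<lambda>t. (Re (f (z + t *\<^sub>R axis i c)))\<^sup>2 + (Im (f (z + t *\<^sub>R axis i c)))\<^sup>2 + e) has_real_derivative
      (2 * (Re (c * g z) * Re (f (z + 0 *\<^sub>R axis i c))) + 2 * (Im (c * g z) * Im (f (z + 0 *\<^sub>R axis i c))) + 0)) (at 0)"
    by (intro DERIV_add DERIV_const) (auto intro: DERIV_cong[OF DERIV_power])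
  then show ?thesis
    unfolding X_def cmod_power2 by (rule DERIV_cong) (simp add: algebra_simps)
qed

text \<open>With \<open>M = 4 - ln X\<close>, the product \<open>X * M\<close> has derivative
  \<open>M - 1\<close> times that of \<open>X\<close>; this is the factor
  \<open>3 - ln X\<close>.\<close>

lemma K_directional_derivative:
  assumes "z \<in> U" "0 < e" "e \<le> 1 / 4"
  shows "((\<lambda>t. K e (z + t *\<^sub>R axis i c)) has_real_derivative
    - (2 * Re (cnj (f z) * (c * g z)) * (3 - ln (X e z)) * (K e z)\<^sup>2)) (at 0)"
proof -
  define X' where "X' = 2 * Re (cnj (f z) * (c * g z))"
  have X: "X e z > 0" "4 - ln (X e z) > 0" using X_bounds[OF assms(2,3), of z] by auto
  have "((\<lambda>t. 1 / (X e (z + t *\<^sub>R axis i c) * (4 - ln (X e (z + t *\<^sub>R axis i c))))) has_real_derivative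
    - (X' * (3 - ln (X e z)) * (1 / (X e z * (4 - ln (X e z))))\<^sup>2)) (at 0)"
    using X
    by (auto intro!: derivative_eq_intros X_directional_derivative[OF assms(1), of e c, folded X'_def]
        simp: divide_simps power2_eq_square) (simp add: algebra_simps)
  then show ?thesis by (simp add: X'_def K_def)
qed

lemma f_bounded: "bounded (f ` S)"
  using less_imp_le[OF less] unfolding bounded_iff by blast

lemma K_bounds:
  assumes "0 < e" "e \<le> 1 / 4"
  shows "0 < K e z" "K e z \<le> 1 / e"
proof -
  note X = X_bounds[OF assms, of z]
  let ?M = "4 - ln (X e z)"
  have M: "?M \<ge> 4" using X by linarith
  show "0 < K e z" using X M by (auto simp: K_def)
  have "e * 1 \<le> X e z * ?M" using X M assms by (intro mult_mono) auto
  then show "K e z \<le> 1 / e" unfolding K_def using assms by (intro divide_left_mono) auto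
qed

lemma X_measurable [measurable]: "X e \<in> borel_measurable borel"
  unfolding X_def[abs_def] by measurable

lemma cnj_f_measurable [measurable]: "(\<lambda>z. cnj (f z)) \<in> borel_measurable borel"
  by (rule measurable_compose[OF f_measurable borel_measurable_cnj])

lemma K_measurable [measurable]: "K e \<in> borel_measurable borel"
  unfolding K_def[abs_def] by measurable

text \<open>\<open>D\<close> is the derivative in direction \<open>axis i c\<close> of a bounded
  function supported in a compact subset of \<open>U\<close>. Taking \<open>axis i c\<close> from
  the basis makes the derivative of \<open>\<eta>\<close> in that direction continuous, as
  \<open>Ck\<close> speaks of basis directions.\<close>

lemma caccioppoli_integral_eq_0:
  assumes \<eta>: "\<eta> \<in> test_functions U" and e: "0 < e" "e \<le> 1 / 4" and c: "axis i c \<in> Basis"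
  defines "D \<equiv> \<lambda>z. of_real (2 * \<eta> z * frechet_derivative \<eta> (at z) (axis i c) * K e z
        - (\<eta> z)\<^sup>2 * (2 * Re (cnj (f z) * (c * g z)) * (3 - ln (X e z)) * (K e z)\<^sup>2)) * (cnj (f z) * g z)
      + of_real ((\<eta> z)\<^sup>2 * K e z) * (cnj (c * g z) * g z + cnj (f z) * (c * g2 z))"
  shows "integrable lborel D" "integral\<^sup>L lborel D = 0"
proof -
  obtain S where S: "compact S" "S \<subseteq> U" and out: "\<And>x. x \<notin> S \<Longrightarrow> \<eta> x = 0"
    "\<And>x b. x \<notin> S \<Longrightarrow> frechet_derivative \<eta> (at x) b = 0"
    and cont: "continuous_on UNIV \<eta>" "continuous_on UNIV (\<lambda>x. frechet_derivative \<eta> (at x) (axis i c))"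
    and deriv: "\<And>x b. ((\<lambda>t. \<eta> (x + t *\<^sub>R b)) has_vector_derivative frechet_derivative \<eta> (at x) b) (at 0)"
    using test_function_props[OF \<eta>] c by metis
  define \<Phi> where "\<Phi> z = of_real ((\<eta> z)\<^sup>2 * K e z) * (cnj (f z) * g z)" for z
  have b\<eta>: "bounded (\<eta> ` S)" "bounded ((\<lambda>x. frechet_derivative \<eta> (at x) (axis i c)) ` S)"
    using cont S(1) by (auto intro!: compact_imp_bounded compact_continuous_image continuous_on_subset[OF _ subset_UNIV])
  have of_real: "bounded ((\<lambda>z. complex_of_real (h z)) ` S)" if "bounded (h ` S)" for h
    using that by (rule bounded_image_norm_le) simp
  have cnj: "bounded ((\<lambda>z. cnj (h z)) ` S)" if "bounded (h ` S)" for h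
    using that by (rule bounded_image_norm_le) simp
  have Re: "bounded ((\<lambda>z. Re (h z)) ` S)" if "bounded (h ` S)" for h
    using that by (rule bounded_image_norm_le) (simp add: abs_Re_le_cmod)
  have const: "bounded ((\<lambda>z. k) ` S)" for k :: "'z::real_normed_vector"
    by (rule bounded_subset[of "{k}"]) auto
  have bK: "bounded (K e ` S)"
    using K_bounds[OF e] by (auto simp: bounded_iff abs_of_pos intro!: exI[of _ "1 / e"])
  have "\<bar>ln (X e z)\<bar> \<le> \<bar>ln e\<bar>" for z
    using X_bounds[OF e, of z] e ln_mono[of e "X e z"] by linarith
  then have bln: "bounded ((\<lambda>z. ln (X e z)) ` S)"
    by (auto simp: bounded_iff intro!: exI[of _ "\<bar>ln e\<bar>"])
  note bg = g_bounded_on_compact[OF S]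
  have [measurable]: "\<eta> \<in> borel_measurable borel"
    using cont(1) by (rule borel_measurable_continuous_onI)
  have \<Phi>m: "\<Phi> \<in> borel_measurable borel"
    unfolding \<Phi>_def[abs_def]
    by (intro borel_measurable_times measurable_compose[OF f_measurable borel_measurable_cnj] g_measurable) measurable
  have \<Phi>0: "\<Phi> x = 0" if "x \<notin> S" for x using out(1)[OF that] by (simp add: \<Phi>_def)
  have \<Phi>d: "((\<lambda>t. \<Phi> (z + t *\<^sub>R axis i c)) has_vector_derivative D z) (at 0)" for z
  proof (cases "z \<in> S")
    case True
    then have z: "z \<in> U" using S by auto
    let ?\<eta>' = "frechet_derivative \<eta> (at z) (axis i c)"
    let ?K' = "- (2 * Re (cnj (f z) * (c * g z)) * (3 - ln (X e z)) * (K e z)\<^sup>2)"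
    have "((\<lambda>t. (\<eta> (z + t *\<^sub>R axis i c))\<^sup>2 * K e (z + t *\<^sub>R axis i c)) has_real_derivative
        2 * \<eta> z * ?\<eta>' * K e z + (\<eta> z)\<^sup>2 * ?K') (at 0)"
      using deriv[of z "axis i c"]
      by (auto intro!: derivative_eq_intros K_directional_derivative[OF z e]
          simp: has_real_derivative_iff_has_vector_derivative[symmetric])
    then have 1: "((\<lambda>t. complex_of_real ((\<eta> (z + t *\<^sub>R axis i c))\<^sup>2 * K e (z + t *\<^sub>R axis i c))) has_vector_derivative
        of_real (2 * \<eta> z * ?\<eta>' * K e z + (\<eta> z)\<^sup>2 * ?K')) (at 0)"
      unfolding has_real_derivative_iff_has_vector_derivative
      by (rule bounded_linear.has_vector_derivative[OF bounded_linear_of_real])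
    have 2: "((\<lambda>t. cnj (f (z + t *\<^sub>R axis i c)) * g (z + t *\<^sub>R axis i c)) has_vector_derivative
        (cnj (f (z + 0 *\<^sub>R axis i c)) * (c * g2 z) + cnj (c * g z) * g (z + 0 *\<^sub>R axis i c))) (at 0)"
      by (intro has_vector_derivative_mult g_directional_derivative z
          bounded_linear.has_vector_derivative[OF bounded_linear_cnj] f_directional_derivative)
    show ?thesis
      using has_vector_derivative_mult[OF 1 2] unfolding \<Phi>_def D_def
      by (simp add: algebra_simps)
  next
    case False
    have "((\<lambda>t. \<Phi> (z + t *\<^sub>R axis i c)) has_vector_derivative 0) (at 0)"
      using S(1) False out(1)
      by (intro directional_derivative_outside[where S=S]) (auto simp: \<Phi>_def compact_imp_closed)
    then show ?thesis using out False by (simp add: D_def)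
  qed
  have \<Phi>b: "bounded (range \<Phi>)"
    unfolding \<Phi>_def power2_eq_square
    by (rule bounded_range_if_0_outside[where S=S])
      (use out in \<open>auto intro!: bounded_image_mult of_real cnj b\<eta> bK bg f_bounded\<close>)
  have Db: "bounded (range D)"
    unfolding D_def power2_eq_square
    by (rule bounded_range_if_0_outside[where S=S],
        intro bounded_plus_comp bounded_minus_comp bounded_image_mult of_real cnj Re const b\<eta> bK bln bg f_bounded)
      (use out in auto)
  \<comment> \<open>Measurability of \<open>D\<close>, which contains \<open>g2\<close>, is obtained
    inside the cited lemma from the difference quotients of \<open>\<Phi>\<close>.\<close>
  show "integrable lborel D" "integral\<^sup>L lborel D = 0"
    by (rule integral_directional_derivative_eq_0[OF \<Phi>m S(1) \<Phi>0 \<Phi>d \<Phi>b Db]; assumption)+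
qed

text \<open>The constant is the integral of
  \<open>(\<bar>\<eta>1\<bar> + \<bar>\<eta>2\<bar>)\<^sup>2\<close>, the only term on the right of
  the pointwise inequality that survives integration; it does not involve \<open>e\<close>.\<close>

lemma caccioppoli:
  assumes \<eta>: "\<eta> \<in> test_functions U"
  obtains C where "\<And>e. 0 < e \<Longrightarrow> e \<le> 1 / 4 \<Longrightarrow>
    (\<integral>\<^sup>+z. ennreal ((\<eta> z)\<^sup>2 * (cmod (g z))\<^sup>2 / (X e z * (4 - ln (X e z))\<^sup>2)) \<partial>lborel) \<le> ennreal C"
proof -
  obtain S where S: "compact S" "S \<subseteq> U" and out: "\<And>x. x \<notin> S \<Longrightarrow> \<eta> x = 0"
    "\<And>x b. x \<notin> S \<Longrightarrow> frechet_derivative \<eta> (at x) b = 0"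
    and cont: "continuous_on UNIV \<eta>" "\<And>b. b \<in> Basis \<Longrightarrow> continuous_on UNIV (\<lambda>x. frechet_derivative \<eta> (at x) b)"
    using test_function_props[OF \<eta>] by metis
  define \<eta>1 where "\<eta>1 z = frechet_derivative \<eta> (at z) (axis i 1)" for z
  define \<eta>2 where "\<eta>2 z = frechet_derivative \<eta> (at z) (axis i \<i>)" for z
  define A where "A z = (\<bar>\<eta>1 z\<bar> + \<bar>\<eta>2 z\<bar>)\<^sup>2" for z
  have "continuous_on UNIV A"
    unfolding A_def[abs_def] \<eta>1_def \<eta>2_def by (intro continuous_intros cont axis_in_Basis)
  then have "integrable lborel (\<lambda>z. indicator S z *\<^sub>R A z)"
    by (intro borel_integrable_compact S) (rule continuous_on_subset, auto)
  moreover have "(\<lambda>z. indicator S z *\<^sub>R A z) = A"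
    using out by (auto simp: fun_eq_iff A_def \<eta>1_def \<eta>2_def indicator_def)
  ultimately have A: "integrable lborel A" by simp
  show thesis
  proof
    fix e :: real assume e: "0 < e" "e \<le> 1 / 4"
    define D where "D c z = of_real (2 * \<eta> z * frechet_derivative \<eta> (at z) (axis i c) * K e z
        - (\<eta> z)\<^sup>2 * (2 * Re (cnj (f z) * (c * g z)) * (3 - ln (X e z)) * (K e z)\<^sup>2)) * (cnj (f z) * g z)
      + of_real ((\<eta> z)\<^sup>2 * K e z) * (cnj (c * g z) * g z + cnj (f z) * (c * g2 z))" for c z
    have D: "integrable lborel (D 1)" "integral\<^sup>L lborel (D 1) = 0"
      "integrable lborel (D \<i>)" "integral\<^sup>L lborel (D \<i>) = 0"
      unfolding D_def by (intro caccioppoli_integral_eq_0[OF \<eta> e] axis_in_Basis)+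
    have pw: "(\<eta> z)\<^sup>2 * (cmod (g z))\<^sup>2 / (X e z * (4 - ln (X e z))\<^sup>2) \<le> Re (D 1 z + \<i> * D \<i> z) + A z" for z
      using caccioppoli_pointwise[of e "4 - ln (X e z)" "\<eta> z" "g z" "f z" "\<eta>1 z" "g2 z" "\<eta>2 z"] e X_bounds(4)[OF e, of z]
      unfolding D_def A_def \<eta>1_def \<eta>2_def K_def X_def by simp
    have i1: "integrable lborel (\<lambda>z. D 1 z + \<i> * D \<i> z)" using D by simp
    have "integrable lborel (\<lambda>z. Re (D 1 z + \<i> * D \<i> z) + A z)"
      by (intro Bochner_Integration.integrable_add integrable_Re i1 A)
    moreover have nonneg: "0 \<le> Re (D 1 z + \<i> * D \<i> z) + A z" for z
      by (rule order_trans[OF _ pw]) (use X_bounds(2)[OF e, of z] in simp)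
    ultimately have "(\<integral>\<^sup>+z. ennreal (Re (D 1 z + \<i> * D \<i> z) + A z) \<partial>lborel)
        = ennreal (LINT z|lborel. Re (D 1 z + \<i> * D \<i> z) + A z)"
      by (intro nn_integral_eq_integral) auto
    also have "(LINT z|lborel. Re (D 1 z + \<i> * D \<i> z) + A z) = Re (LINT z|lborel. D 1 z + \<i> * D \<i> z) + integral\<^sup>L lborel A"
      using i1 A by (subst Bochner_Integration.integral_add) (auto simp del: plus_complex.simps)
    also have "(LINT z|lborel. D 1 z + \<i> * D \<i> z) = 0" using D by simp
    finally show "(\<integral>\<^sup>+z. ennreal ((\<eta> z)\<^sup>2 * (cmod (g z))\<^sup>2 / (X e z * (4 - ln (X e z))\<^sup>2)) \<partial>lborel)
        \<le> ennreal (integral\<^sup>L lborel A)"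
      using nn_integral_mono[of lborel "\<lambda>z. ennreal ((\<eta> z)\<^sup>2 * (cmod (g z))\<^sup>2 / (X e z * (4 - ln (X e z))\<^sup>2))"
          "\<lambda>z. ennreal (Re (D 1 z + \<i> * D \<i> z) + A z)"] pw by (simp add: ennreal_leI)
  qed
qed

end

subsection \<open>Weak derivatives of the reciprocal logarithm\<close>

text \<open>The derivative \<open>2 - 2 * ln x\<close> is positive on (0, 1]; the proof uses
  \<open>ln x \<le> x - 1\<close> at \<open>b / a\<close> instead. It will compare
  \<open>cmod (f z)\<close> with the larger \<open>sqrt (X e z)\<close>.\<close>

lemma mult_log_mono:
  fixes a b :: real
  assumes "0 < a" "a \<le> b" "b \<le> 1"
  shows "a * (4 - 2 * ln a) \<le> b * (4 - 2 * ln b)"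
proof -
  have "ln b - ln a \<le> b / a - 1"
    using ln_le_minus_one[of "b / a"] assms by (simp add: ln_div)
  then have "a * (ln b - ln a) \<le> a * (b / a - 1)"
    using assms by (intro mult_left_mono) auto
  also have "\<dots> = b - a" using assms by (simp add: field_simps)
  finally have 1: "a * (ln b - ln a) \<le> b - a" .
  have "ln b \<le> 0" using assms ln_le_minus_one[of b] by linarith
  then have "0 \<le> (b - a) * (2 - 2 * ln b)"
    using assms(2) by (intro mult_nonneg_nonneg) linarith+
  then show ?thesis using 1 by (simp add: algebra_simps)
qed

lemma Lp_locI:
  fixes h :: "'a::euclidean_space \<Rightarrow> real"
  assumes [measurable]: "h \<in> borel_measurable borel" and "p \<noteq> \<infinity>" and U: "open U"
    and int: "\<And>K. compact K \<Longrightarrow> K \<subseteq> U \<Longrightarrow> integrable lborel (\<lambda>x. indicator K x * \<bar>h x\<bar> powr enn2real p)"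
  shows "h \<in> Lp_loc p U"
proof -
  have "h \<in> borel_measurable (lebesgue_on U)"
    by (intro measurable_restrict_space1 measurable_completion) simp
  moreover have "integrable (lebesgue_on K) (\<lambda>x. \<bar>h x\<bar> powr enn2real p)" if K: "compact K" "K \<subseteq> U" for K
  proof -
    have [measurable]: "K \<in> sets borel" using K by (auto intro: borel_compact)
    have "integrable lebesgue (\<lambda>x. indicator K x *\<^sub>R \<bar>h x\<bar> powr enn2real p)"
      using int[OF K] by (subst integrable_completion) auto
    then show ?thesis by (subst integrable_restrict_space) auto
  qed
  ultimately show ?thesis using assms by (simp add: Lp_loc_def)
qed

lemma Lp_loc_cong:
  assumes "\<And>x. x \<in> U \<Longrightarrow> u x = v x" "u \<in> Lp_loc p U"
  shows "v \<in> Lp_loc p U"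
proof -
  have "v \<in> borel_measurable (lebesgue_on U)"
    using assms by (subst measurable_cong[where g=u]) (auto simp: Lp_loc_def)
  moreover have "\<exists>C. AE x in lebesgue_on K. \<bar>v x\<bar> \<le> C" if K: "K \<subseteq> U" "\<exists>C. AE x in lebesgue_on K. \<bar>u x\<bar> \<le> C" for K
  proof -
    obtain C where "AE x in lebesgue_on K. \<bar>u x\<bar> \<le> C" using K by auto
    then have "AE x in lebesgue_on K. \<bar>v x\<bar> \<le> C"
      using AE_space by eventually_elim (use K assms(1) in auto)
    then show ?thesis by blast
  qed
  moreover have "integrable (lebesgue_on K) (\<lambda>x. \<bar>v x\<bar> powr q)"
    if K: "K \<subseteq> U" "integrable (lebesgue_on K) (\<lambda>x. \<bar>u x\<bar> powr q)" for K q
    using K assms(1) by (subst Bochner_Integration.integrable_cong[where g="\<lambda>x. \<bar>u x\<bar> powr q"]) auto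
  ultimately show ?thesis using assms(2) by (auto simp: Lp_loc_def split: if_splits)
qed

text \<open>Lets the theorem pass between its \<open>v\<close>, prescribed on \<open>U\<close> only,
  and the globally defined function of the locale.\<close>

lemma W1_loc_cong:
  assumes "\<And>x. x \<in> U \<Longrightarrow> u x = v x" "u \<in> W1_loc p U"
  shows "v \<in> W1_loc p U"
proof -
  have "has_weak_partial U b v g" if "has_weak_partial U b u g" for b g
  proof -
    have "(LINT x|lebesgue_on U. u x * h x) = (LINT x|lebesgue_on U. v x * h x)" for h
      using assms(1) by (intro Bochner_Integration.integral_cong) auto
    then show ?thesis using that Lp_loc_cong[OF assms(1)] by (auto simp: has_weak_partial_def)
  qed
  then show ?thesis using assms Lp_loc_cong[OF assms(1)] by (fastforce simp: W1_loc_def)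
qed

lemma integral_lebesgue_on_eq_lborel:
  fixes h :: "'a::euclidean_space \<Rightarrow> real"
  assumes "open U" "h \<in> borel_measurable borel" "\<And>x. x \<notin> U \<Longrightarrow> h x = 0"
  shows "(LINT x|lebesgue_on U. h x) = (LINT x|lborel. h x)"
proof -
  have "(LINT x|lebesgue_on U. h x) = (LINT x|lebesgue. indicator U x *\<^sub>R h x)"
    using assms by (intro integral_restrict_space) auto
  also have "(\<lambda>x. indicator U x *\<^sub>R h x) = h"
    using assms(3) by (auto simp: fun_eq_iff indicator_def)
  also have "integral\<^sup>L lebesgue h = integral\<^sup>L lborel h"
    using assms by (intro integral_completion) auto
  finally show ?thesis by simp
qed

section \<open>Local square integrability of \<open>Q\<close> and the weak partials of
  \<open>v\<close>\<close>

context holomorphic_direction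
begin

text \<open>\<open>Q\<close>, and \<open>G\<close> below, vanish on the zero set of \<open>f\<close>, where they divide by 0.\<close>

definition Q :: "complex ^ 'n \<Rightarrow> real"
  where "Q z = cmod (g z) / (cmod (f z) * (4 - 2 * ln (cmod (f z))))"

lemma Q_measurable [measurable]: "Q \<in> borel_measurable borel"
  unfolding Q_def[abs_def] by measurable

lemma ln_f: "f z \<noteq> 0 \<Longrightarrow> ln (cmod (f z)) \<le> - (1 / 2)"
  using less[of z] by (intro ln_le_minus_half) auto

lemma Q_nonneg: "0 \<le> Q z"
  using ln_f[of z] by (cases "f z = 0") (auto simp: Q_def)

definition eps :: "nat \<Rightarrow> real"
  where "eps n = 1 / (real n + 4)"

lemma eps: "0 < eps n" "eps n \<le> 1 / 4" "eps \<longlonglongrightarrow> 0"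
proof -
  show "0 < eps n" "eps n \<le> 1 / 4" by (auto simp: eps_def field_simps)
  show "eps \<longlonglongrightarrow> 0" unfolding eps_def by real_asymp
qed

lemma X_eps_tendsto: "(\<lambda>n. X (eps n) z) \<longlonglongrightarrow> (cmod (f z))\<^sup>2"
  using tendsto_add[OF tendsto_const[of "(cmod (f z))\<^sup>2"] eps(3)] by (simp add: X_def)

lemma ln_X_eps_tendsto: "f z \<noteq> 0 \<Longrightarrow> (\<lambda>n. ln (X (eps n) z)) \<longlonglongrightarrow> 2 * ln (cmod (f z))"
  using tendsto_ln[OF X_eps_tendsto, of z] by (simp add: ln_realpow)

lemma Q_L2_test:
  assumes \<eta>: "\<eta> \<in> test_functions U"
  shows "(\<integral>\<^sup>+z. ennreal ((\<eta> z)\<^sup>2 * (Q z)\<^sup>2) \<partial>lborel) < \<infinity>"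
proof -
  define u where "u n z = (\<eta> z)\<^sup>2 * (cmod (g z))\<^sup>2 / (X (eps n) z * (4 - ln (X (eps n) z))\<^sup>2)" for n z
  obtain C where C: "(\<integral>\<^sup>+z. ennreal (u n z) \<partial>lborel) \<le> ennreal C" for n
  proof -
    fix thesis
    assume *: "\<And>C. (\<And>n. (\<integral>\<^sup>+z. ennreal (u n z) \<partial>lborel) \<le> ennreal C) \<Longrightarrow> thesis"
    show thesis
      by (rule caccioppoli[OF \<eta>], rule *, unfold u_def) (use eps(1,2) in blast)
  qed
  have [measurable]: "\<eta> \<in> borel_measurable borel"
    using \<eta> by (metis test_function_props borel_measurable_continuous_onI)
  have "ennreal ((\<eta> z)\<^sup>2 * (Q z)\<^sup>2) \<le> liminf (\<lambda>n. ennreal (u n z))" for z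
  proof (cases "f z = 0")
    case False
    have "4 - 2 * ln (cmod (f z)) > 0" using ln_f[OF False] by simp
    then have "(\<lambda>n. u n z) \<longlonglongrightarrow> (\<eta> z)\<^sup>2 * (cmod (g z))\<^sup>2 / ((cmod (f z))\<^sup>2 * (4 - 2 * ln (cmod (f z)))\<^sup>2)"
      unfolding u_def using False by (intro tendsto_intros X_eps_tendsto ln_X_eps_tendsto) auto
    moreover have "(\<eta> z)\<^sup>2 * (cmod (g z))\<^sup>2 / ((cmod (f z))\<^sup>2 * (4 - 2 * ln (cmod (f z)))\<^sup>2) = (\<eta> z)\<^sup>2 * (Q z)\<^sup>2"
      by (simp add: Q_def power_divide power_mult_distrib)
    ultimately have "(\<lambda>n. ennreal (u n z)) \<longlonglongrightarrow> ennreal ((\<eta> z)\<^sup>2 * (Q z)\<^sup>2)" by (intro tendsto_ennrealI) simp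
    then have "liminf (\<lambda>n. ennreal (u n z)) = ennreal ((\<eta> z)\<^sup>2 * (Q z)\<^sup>2)"
      by (intro lim_imp_Liminf) auto
    then show ?thesis by simp
  qed (simp add: Q_def)
  then have "(\<integral>\<^sup>+z. ennreal ((\<eta> z)\<^sup>2 * (Q z)\<^sup>2) \<partial>lborel) \<le> (\<integral>\<^sup>+z. liminf (\<lambda>n. ennreal (u n z)) \<partial>lborel)"
    by (intro nn_integral_mono)
  also have "\<dots> \<le> liminf (\<lambda>n. \<integral>\<^sup>+z. ennreal (u n z) \<partial>lborel)"
    by (intro nn_integral_liminf) (auto simp: u_def)
  also have "\<dots> \<le> limsup (\<lambda>n. \<integral>\<^sup>+z. ennreal (u n z) \<partial>lborel)"
    by (intro Liminf_le_Limsup) auto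
  also have "\<dots> \<le> ennreal C" by (intro Limsup_bounded) (simp add: C)
  finally show ?thesis by (simp add: le_less_trans)
qed

text \<open>\<open>Q_L2_test\<close> controls \<open>Q\<close> only against a cutoff. Near each
  point a bump stays above half its value there, so the measure with density
  \<open>Q\<^sup>2\<close> is locally finite, and finitely many such neighbourhoods cover the
  compact set.\<close>

lemma Q_square_integrable:
  assumes S: "compact S" "S \<subseteq> U"
  shows "integrable lborel (\<lambda>z. indicator S z * (Q z)\<^sup>2)"
proof -
  define N where "N = density lborel (\<lambda>z. ennreal ((Q z)\<^sup>2))"
  have "\<exists>W. open W \<and> x \<in> W \<and> emeasure N W < \<infinity>" if "x \<in> S" for x
  proof -
    have "x \<in> U" using S that by auto
    obtain l u where lu: "cbox l u \<subseteq> U" "x \<in> box l u"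
      by (rule open_contains_cbox[OF open_U \<open>x \<in> U\<close>])
    define \<eta> where "\<eta> = (box_bump l u :: complex ^ 'n \<Rightarrow> real)"
    have \<eta>: "\<eta> \<in> test_functions U"
      unfolding \<eta>_def by (rule test_functions_boxI[OF Ck_box_bump _ lu(1)]) (simp add: box_bump_eq_0_iff)
    have cont: "continuous_on UNIV \<eta>" using Ck_box_bump[of 0 l u] by (simp add: \<eta>_def)
    have [measurable]: "\<eta> \<in> borel_measurable borel" using cont by (rule borel_measurable_continuous_onI)
    have pos: "\<eta> x > 0" using lu by (simp add: \<eta>_def box_bump_pos_iff)
    define W where "W = {z. \<eta> x / 2 < \<eta> z}"
    have W: "open W" "x \<in> W"
      unfolding W_def using cont pos by (auto intro!: open_Collect_less continuous_intros)
    have [measurable]: "W \<in> sets borel" using W by simp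
    have "emeasure N W = (\<integral>\<^sup>+z. ennreal ((Q z)\<^sup>2) * indicator W z \<partial>lborel)"
      unfolding N_def by (intro emeasure_density) auto
    also have "\<dots> \<le> (\<integral>\<^sup>+z. ennreal (4 / (\<eta> x)\<^sup>2) * ennreal ((\<eta> z)\<^sup>2 * (Q z)\<^sup>2) \<partial>lborel)"
    proof (intro nn_integral_mono)
      fix z
      show "ennreal ((Q z)\<^sup>2) * indicator W z \<le> ennreal (4 / (\<eta> x)\<^sup>2) * ennreal ((\<eta> z)\<^sup>2 * (Q z)\<^sup>2)"
      proof (cases "z \<in> W")
        case True
        then have "(\<eta> x / 2)\<^sup>2 \<le> (\<eta> z)\<^sup>2" using pos by (intro power_mono) (auto simp: W_def)
        then have "1 \<le> 4 / (\<eta> x)\<^sup>2 * (\<eta> z)\<^sup>2" using pos by (simp add: field_simps)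
        then have "1 * (Q z)\<^sup>2 \<le> 4 / (\<eta> x)\<^sup>2 * (\<eta> z)\<^sup>2 * (Q z)\<^sup>2" by (intro mult_right_mono) auto
        then show ?thesis using True by (simp add: ennreal_mult[symmetric] mult.assoc ennreal_leI)
      qed simp
    qed
    also have "\<dots> = ennreal (4 / (\<eta> x)\<^sup>2) * (\<integral>\<^sup>+z. ennreal ((\<eta> z)\<^sup>2 * (Q z)\<^sup>2) \<partial>lborel)"
      by (intro nn_integral_cmult) simp
    also have "\<dots> < \<infinity>" using Q_L2_test[OF \<eta>] by (simp add: ennreal_mult_less_top)
    finally show ?thesis using W by blast
  qed
  then obtain W where W: "\<And>x. x \<in> S \<Longrightarrow> open (W x)" "\<And>x. x \<in> S \<Longrightarrow> x \<in> W x" "\<And>x. x \<in> S \<Longrightarrow> emeasure N (W x) < \<infinity>"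
    by metis
  obtain T where T: "T \<subseteq> S" "finite T" "S \<subseteq> (\<Union>x\<in>T. W x)"
    by (rule compactE_image[OF S(1), of S W]) (use W(1,2) in auto)
  have sets: "W x \<in> sets N" if "x \<in> T" for x
    using W(1) T(1) that by (auto simp: N_def)
  have "emeasure N S \<le> emeasure N (\<Union>x\<in>T. W x)"
    using T sets by (intro emeasure_mono) auto
  also have "\<dots> \<le> (\<Sum>x\<in>T. emeasure N (W x))"
    using T sets by (intro emeasure_subadditive_finite) auto
  also have "\<dots> < \<infinity>" using W(3) T by (auto simp: less_top[symmetric])
  finally have "emeasure N S < \<infinity>" .
  moreover have [measurable]: "S \<in> sets borel" using S by (auto intro: borel_compact)
  ultimately have "(\<integral>\<^sup>+z. ennreal ((Q z)\<^sup>2) * indicator S z \<partial>lborel) < \<infinity>"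
    unfolding N_def by (subst (asm) emeasure_density) auto
  also have "(\<lambda>z. ennreal ((Q z)\<^sup>2) * indicator S z) = (\<lambda>z. ennreal (norm (indicator S z * (Q z)\<^sup>2)))"
    by (auto simp: fun_eq_iff indicator_def)
  finally show ?thesis by (auto simp: integrable_iff_bounded)
qed

lemma Q_integrable:
  assumes S: "compact S" "S \<subseteq> U"
  shows "integrable lborel (\<lambda>z. indicator S z * Q z)"
proof -
  have [measurable]: "S \<in> sets borel" using S by (auto intro: borel_compact)
  have "integrable lborel (\<lambda>z. indicator S z * 1 + indicator S z * (Q z)\<^sup>2)"
    using S by (intro Bochner_Integration.integrable_add Q_square_integrable integrable_mult_left)
      (auto intro: emeasure_compact_finite)
  moreover have "Q z \<le> 1 + (Q z)\<^sup>2" for z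
    using sum_squares_bound[of 1 "Q z"] Q_nonneg[of z] by simp
  ultimately show ?thesis
    by (auto simp: indicator_def Q_nonneg intro: Bochner_Integration.integrable_bound)
qed

definition v :: "complex ^ 'n \<Rightarrow> real"
  where "v z = (if f z = 0 then 0 else 1 / ln (cmod (f z)))"

text \<open>Off the zero set this is the derivative of \<open>1 / ln |f|\<close> in the real
  direction \<open>axis i c\<close>, since \<open>ln |f|\<close> has derivative
  \<open>Re (c * g z / f z)\<close> there.\<close>

definition G :: "complex \<Rightarrow> complex ^ 'n \<Rightarrow> real"
  where "G c z = - (Re (c * g z / f z) / (ln (cmod (f z)))\<^sup>2)"

lemma v_measurable [measurable]: "v \<in> borel_measurable borel"
  unfolding v_def[abs_def] by measurable

lemma G_measurable [measurable]: "G c \<in> borel_measurable borel"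
  unfolding G_def[abs_def] by measurable

lemma v_bound: "\<bar>v z\<bar> \<le> 2"
proof (cases "f z = 0")
  case False
  have "1 / \<bar>ln (cmod (f z))\<bar> \<le> 1 / (1 / 2)"
    using ln_f[OF False] by (intro divide_left_mono) auto
  then show ?thesis using False by (simp add: v_def)
qed (simp add: v_def)

lemma G_bound:
  assumes "cmod c = 1"
  shows "\<bar>G c z\<bar> \<le> 20 * Q z"
proof (cases "f z = 0")
  case False
  define L where "L = - ln (cmod (f z))"
  have L: "L \<ge> 1 / 2" using ln_f[OF False] by (simp add: L_def)
  have "\<bar>Re (c * g z / f z)\<bar> \<le> cmod (g z) / cmod (f z)"
    using abs_Re_le_cmod[of "c * g z / f z"] assms by (simp add: norm_mult norm_divide)
  then have "\<bar>G c z\<bar> \<le> cmod (g z) / cmod (f z) / L\<^sup>2"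
    unfolding G_def L_def abs_minus_cancel abs_divide abs_power2 power2_minus by (intro divide_right_mono) auto
  also have "\<dots> \<le> cmod (g z) / cmod (f z) * (20 / (4 + 2 * L))"
  proof -
    \<comment> \<open>From \<open>L \<ge> 1 / 2\<close> follow \<open>4 \<le> 16 * L\<^sup>2\<close>
      and \<open>2 * L \<le> 4 * L\<^sup>2\<close>, whose sum gives the constant 20.\<close>
    have "(1 / 2) * (1 / 2) \<le> L * L" "(1 / 2) * L \<le> L * L"
    using L mult_mono[OF L L] mult_right_mono[OF L, of L] by auto
    then have "4 + 2 * L \<le> 20 * L\<^sup>2" by (simp add: power2_eq_square)
    then have "1 / L\<^sup>2 \<le> 20 / (4 + 2 * L)" using L by (simp add: field_simps)
    then have "cmod (g z) / cmod (f z) * (1 / L\<^sup>2) \<le> cmod (g z) / cmod (f z) * (20 / (4 + 2 * L))"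
      by (intro mult_left_mono) auto
    then show ?thesis by simp
  qed
  also have "\<dots> = 20 * Q z" by (simp add: Q_def L_def)
  finally show ?thesis .
qed (simp add: G_def Q_def)

text \<open>A bound independent of \<open>e\<close> is what dominated convergence requires.
  \<open>mult_log_mono\<close> replaces \<open>sqrt (X e z)\<close> by \<open>cmod (f z)\<close> in
  the denominator, and 72 is 4 times the 18 in \<open>4 + L \<le> 18 * L\<^sup>2\<close>.\<close>

lemma G_approx_bound:
  assumes "cmod c = 1" "0 < e" "e \<le> 1 / 4"
  shows "\<bar>4 * Re (cnj (f z) * (c * g z)) / (X e z * (ln (X e z))\<^sup>2)\<bar> \<le> 72 * Q z"
proof (cases "f z = 0")
  case False
  note X = X_bounds[OF assms(2,3), of z]
  define L where "L = - ln (X e z)"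
  have L: "L \<ge> 1 / 2" using X by (simp add: L_def)
  have fX: "cmod (f z) \<le> sqrt (X e z)"
    using assms by (intro real_le_rsqrt) (simp add: X_def)
  have "(1 / 2) * (1 / 2) \<le> L * L" "(1 / 2) * L \<le> L * L"
    using L mult_mono[OF L L] mult_right_mono[OF L, of L] by auto
  then have "4 + L \<le> 18 * L\<^sup>2" by (simp add: power2_eq_square)
  then have L2: "1 / L\<^sup>2 \<le> 18 / (4 + L)" using L by (simp add: field_simps)
  have mono: "cmod (f z) * (4 - 2 * ln (cmod (f z))) \<le> sqrt (X e z) * (4 + L)"
    using mult_log_mono[of "cmod (f z)" "sqrt (X e z)"] False fX X
    by (simp add: ln_sqrt L_def)
  have pos: "0 < cmod (f z) * (4 - 2 * ln (cmod (f z)))"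
    using False ln_f[OF False] by simp
  have "\<bar>4 * Re (cnj (f z) * (c * g z))\<bar> \<le> 4 * (cmod (f z) * cmod (g z))"
    using abs_Re_le_cmod[of "cnj (f z) * (c * g z)"] assms by (simp add: norm_mult)
  then have "\<bar>4 * Re (cnj (f z) * (c * g z)) / (X e z * (ln (X e z))\<^sup>2)\<bar> \<le> 4 * (cmod (f z) * cmod (g z)) / (X e z * L\<^sup>2)"
    using X unfolding abs_divide L_def by (simp add: abs_mult divide_right_mono)
  also have "\<dots> \<le> 4 * (sqrt (X e z) * cmod (g z)) / (X e z * L\<^sup>2)"
    using fX X by (intro divide_right_mono mult_left_mono mult_right_mono) auto
  also have "\<dots> = 4 * cmod (g z) / sqrt (X e z) * (1 / L\<^sup>2)"
  proof -
    have "4 * (b * k) / (b\<^sup>2 * l) = 4 * k / b * (1 / l)" if "b > 0" for b k l :: real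
      using that by (simp add: power2_eq_square)
    from this[of "sqrt (X e z)"] show ?thesis using X by simp
  qed
  also have "\<dots> \<le> 4 * cmod (g z) / sqrt (X e z) * (18 / (4 + L))"
    using L2 X by (intro mult_left_mono) auto
  also have "\<dots> = 72 * (cmod (g z) / (sqrt (X e z) * (4 + L)))" by simp
  also have "\<dots> \<le> 72 * Q z"
    unfolding Q_def using mono pos by (intro mult_left_mono divide_left_mono) (auto intro: mult_pos_pos less_le_trans)
  finally show ?thesis .
qed (simp add: Q_def)

text \<open>The difference of the two integrands is the directional derivative of
  \<open>2 / ln X * \<phi>\<close>. The regularization keeps \<open>X\<close> above
  \<open>e\<close>, so everything is bounded. The right-hand side has no minus sign because
  differentiating the reciprocal supplies a second one.\<close>

lemma approx_weak_derivative:
  assumes \<phi>: "\<phi> \<in> test_functions U" and e: "0 < e" "e \<le> 1 / 4" and c: "axis i c \<in> Basis"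
  shows "(LINT z|lborel. 2 / ln (X e z) * frechet_derivative \<phi> (at z) (axis i c)) =
    (LINT z|lborel. 4 * Re (cnj (f z) * (c * g z)) / (X e z * (ln (X e z))\<^sup>2) * \<phi> z)"
proof -
  obtain S where S: "compact S" "S \<subseteq> U" and out: "\<And>x. x \<notin> S \<Longrightarrow> \<phi> x = 0"
    "\<And>x b. x \<notin> S \<Longrightarrow> frechet_derivative \<phi> (at x) b = 0"
    and cont: "continuous_on UNIV \<phi>" "continuous_on UNIV (\<lambda>x. frechet_derivative \<phi> (at x) (axis i c))"
    and deriv: "\<And>x b. ((\<lambda>t. \<phi> (x + t *\<^sub>R b)) has_vector_derivative frechet_derivative \<phi> (at x) b) (at 0)"
    using test_function_props[OF \<phi>] c by metis
  let ?\<phi>' = "\<lambda>z. frechet_derivative \<phi> (at z) (axis i c)"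
  define A where "A z = 2 / ln (X e z) * ?\<phi>' z" for z
  define B where "B z = 4 * Re (cnj (f z) * (c * g z)) / (X e z * (ln (X e z))\<^sup>2) * \<phi> z" for z
  note X = X_bounds[OF e]
  have [measurable]: "\<phi> \<in> borel_measurable borel" "?\<phi>' \<in> borel_measurable borel"
    using cont by (auto intro: borel_measurable_continuous_onI)
  have b\<phi>: "bounded (\<phi> ` S)" "bounded (?\<phi>' ` S)"
    using cont S(1) by (auto intro!: compact_imp_bounded compact_continuous_image continuous_on_subset[OF _ subset_UNIV])
  have ln: "1 / 2 \<le> \<bar>ln (X e z)\<bar>" for z using X(4)[of z] by linarith
  have "\<bar>2 / ln (X e z)\<bar> \<le> 4" for z
    using ln[of z] divide_left_mono[OF ln[of z], of 2] by (simp add: abs_divide)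
  then have b1: "bounded ((\<lambda>z. 2 / ln (X e z)) ` S)"
    by (auto simp: bounded_iff)
  have "1 / (X e z * (ln (X e z))\<^sup>2) \<le> 1 / (e * (1 / 2)\<^sup>2)" for z
    using e X(1)[of z] power_mono[OF ln[of z], of 2] X(2)[of z] ln[of z]
    by (intro divide_left_mono mult_mono mult_pos_pos) auto
  then have b2: "bounded ((\<lambda>z. 1 / (X e z * (ln (X e z))\<^sup>2)) ` S)"
    using X(2) unfolding bounded_iff by (intro exI[of _ "1 / (e * (1 / 2)\<^sup>2)"]) (auto simp: abs_mult abs_of_pos)
  have b3: "bounded ((\<lambda>z. 4 * Re (cnj (f z) * (c * g z))) ` S)"
  proof -
    have "bounded ((\<lambda>z. of_real 4 * (f z * (c * g z))) ` S)"
      by (intro bounded_image_mult f_bounded g_bounded_on_compact S bounded_subset[of "{c}" "(\<lambda>z. c) ` S"]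
          bounded_subset[of "{of_real 4}" "(\<lambda>z. of_real 4) ` S"]) auto
    then show ?thesis
    proof (rule bounded_image_norm_le)
      show "norm (4 * Re (cnj (f z) * (c * g z))) \<le> norm (of_real 4 * (f z * (c * g z)))" for z
        using abs_Re_le_cmod[of "cnj (f z) * (c * g z)"] by (simp add: norm_mult abs_mult)
    qed
  qed
  have bA: "bounded (range A)"
    by (rule bounded_range_if_0_outside[where S=S])
      (unfold A_def[abs_def], intro bounded_image_mult b1 b\<phi>, use out in simp)
  have "B = (\<lambda>z. (4 * Re (cnj (f z) * (c * g z))) * (1 / (X e z * (ln (X e z))\<^sup>2)) * \<phi> z)"
    by (simp add: B_def fun_eq_iff)
  then have bB: "bounded (range B)"
    using bounded_range_if_0_outside[OF bounded_image_mult[OF bounded_image_mult[OF b3 b2] b\<phi>(1)]] out by auto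
  have Am [measurable]: "A \<in> borel_measurable borel" unfolding A_def[abs_def] by measurable
  have Bm [measurable]: "B \<in> borel_measurable borel"
    unfolding B_def[abs_def] by measurable
  have int: "integrable lborel h" if h: "h \<in> borel_measurable borel" "bounded (range h)" "\<And>x. x \<notin> S \<Longrightarrow> h x = 0"
    for h :: "complex ^ 'n \<Rightarrow> real"
  proof -
    obtain C where C: "\<And>x. norm (h x) \<le> C" using h(2) by (auto simp: bounded_iff)
    show ?thesis
    proof (rule Bochner_Integration.integrable_bound)
      show "integrable lborel (\<lambda>x. indicator S x * C)"
        using S by (intro integrable_mult_left) (auto intro!: integrable_real_indicator emeasure_compact_finite borel_compact)
      show "AE x in lborel. norm (h x) \<le> norm (indicator S x * C)"
        using C h(3) by (intro AE_I2) (metis abs_ge_self indicator_simps mult_1 mult_zero_left norm_zero order_trans real_norm_def norm_ge_zero order_refl)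
    qed (use h in simp)
  qed
  have iA: "integrable lborel A" by (rule int[OF Am bA]) (simp add: A_def out)
  have iB: "integrable lborel B" by (rule int[OF Bm bB]) (simp add: B_def out)
  define F where "F z = 2 / ln (X e z) * \<phi> z" for z
  have "integral\<^sup>L lborel (\<lambda>z. A z - B z) = 0"
  proof (rule integral_directional_derivative_eq_0(2)[where F=F and K=S and b="axis i c"])
    show "F \<in> borel_measurable borel" unfolding F_def[abs_def] by measurable
    show "F x = 0" if "x \<notin> S" for x using out that by (simp add: F_def)
    show "bounded (range F)"
      unfolding F_def[abs_def]
      by (rule bounded_range_if_0_outside[where S=S]) (intro bounded_image_mult b1 b\<phi>, use out in simp)
    obtain a b where "\<And>x. norm (A x) \<le> a" "\<And>x. norm (B x) \<le> b" using bA bB by (auto simp: bounded_iff)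
    then have "norm (A x - B x) \<le> a + b" for x by (meson norm_triangle_le_diff add_mono order_trans norm_triangle_ineq4)
    then show "bounded (range (\<lambda>z. A z - B z))" by (auto simp: bounded_iff)
    show "((\<lambda>t. F (z + t *\<^sub>R axis i c)) has_vector_derivative A z - B z) (at 0)" for z
    proof (cases "z \<in> S")
      case True
      then have z: "z \<in> U" using S by auto
      have "ln (X e z) \<noteq> 0" using X(4)[of z] by linarith
      then have "((\<lambda>t. F (z + t *\<^sub>R axis i c)) has_real_derivative A z - B z) (at 0)"
        unfolding F_def A_def B_def using deriv[of z "axis i c"] X(2)[of z]
        by (auto intro!: derivative_eq_intros X_directional_derivative[OF z]
            simp: has_real_derivative_iff_has_vector_derivative[symmetric] divide_simps power2_eq_square)
      then show ?thesis by (simp add: has_real_derivative_iff_has_vector_derivative)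
    next
      case False
      have "((\<lambda>t. F (z + t *\<^sub>R axis i c)) has_vector_derivative 0) (at 0)"
        using S(1) False out(1)
        by (intro directional_derivative_outside[where S=S]) (auto simp: F_def compact_imp_closed)
      then show ?thesis using out False by (simp add: A_def B_def)
    qed
  qed (fact S)
  then have "integral\<^sup>L lborel A = integral\<^sup>L lborel B" using iA iB by simp
  then show ?thesis unfolding A_def B_def .
qed

lemma weak_derivative_lborel:
  assumes \<phi>: "\<phi> \<in> test_functions U" and c: "axis i c \<in> Basis" "cmod c = 1"
  shows "(LINT z|lborel. v z * frechet_derivative \<phi> (at z) (axis i c)) = - (LINT z|lborel. G c z * \<phi> z)"
proof -
  obtain S where S: "compact S" "S \<subseteq> U" and out: "\<And>x. x \<notin> S \<Longrightarrow> \<phi> x = 0"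
    "\<And>x b. x \<notin> S \<Longrightarrow> frechet_derivative \<phi> (at x) b = 0"
    and cont: "continuous_on UNIV \<phi>" "continuous_on UNIV (\<lambda>x. frechet_derivative \<phi> (at x) (axis i c))"
    using test_function_props[OF \<phi>] c by metis
  let ?\<phi>' = "\<lambda>z. frechet_derivative \<phi> (at z) (axis i c)"
  let ?B = "\<lambda>e z. 4 * Re (cnj (f z) * (c * g z)) / (X e z * (ln (X e z))\<^sup>2)"
  have [measurable]: "\<phi> \<in> borel_measurable borel" "?\<phi>' \<in> borel_measurable borel" "S \<in> sets borel"
    using cont S by (auto intro: borel_measurable_continuous_onI borel_compact)
  obtain C where C: "\<And>x. x \<in> S \<Longrightarrow> \<bar>\<phi> x\<bar> \<le> C" "\<And>x. x \<in> S \<Longrightarrow> \<bar>?\<phi>' x\<bar> \<le> C"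
  proof -
    have "bounded (\<phi> ` S)" "bounded (?\<phi>' ` S)"
      using cont S(1) by (auto intro!: compact_imp_bounded compact_continuous_image continuous_on_subset[OF _ subset_UNIV])
    then obtain a b where "\<And>x. x \<in> S \<Longrightarrow> \<bar>\<phi> x\<bar> \<le> a" "\<And>x. x \<in> S \<Longrightarrow> \<bar>?\<phi>' x\<bar> \<le> b"
      by (auto simp: bounded_iff)
    then show thesis using that[of "max a b"] by (meson max.coboundedI1 max.coboundedI2)
  qed
  have lim1: "(\<lambda>n. LINT z|lborel. 2 / ln (X (eps n) z) * ?\<phi>' z) \<longlonglongrightarrow> (LINT z|lborel. v z * ?\<phi>' z)"
  proof (rule integral_dominated_convergence[where w="\<lambda>z. indicator S z * (4 * C)"])
    show "integrable lborel (\<lambda>z. indicator S z * (4 * C))"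
      using S by (intro integrable_mult_left) (auto intro: emeasure_compact_finite)
    have "(\<lambda>n. 2 / ln (X (eps n) z)) \<longlonglongrightarrow> v z" for z
    proof (cases "f z = 0")
      case True
      \<comment> \<open>At a zero \<open>X (eps n) z\<close> equals \<open>eps n\<close>, whose
        logarithm diverges; the limit is the prescribed value 0 of \<open>v\<close>.\<close>
      have "(\<lambda>n. 2 / ln (1 / (real n + 4))) \<longlonglongrightarrow> 0" by real_asymp
      then show ?thesis using True by (simp add: v_def X_def eps_def)
    next
      case False
      have "ln (cmod (f z)) \<noteq> 0" using ln_f[OF False] by linarith
      then have "(\<lambda>n. 2 / ln (X (eps n) z)) \<longlonglongrightarrow> 2 / (2 * ln (cmod (f z)))"
        using False by (intro tendsto_intros ln_X_eps_tendsto) auto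
      then show ?thesis using False by (simp add: v_def)
    qed
    then show "AE z in lborel. (\<lambda>n. 2 / ln (X (eps n) z) * ?\<phi>' z) \<longlonglongrightarrow> v z * ?\<phi>' z"
      by (intro AE_I2 tendsto_mult tendsto_const)
    show "AE z in lborel. norm (2 / ln (X (eps n) z) * ?\<phi>' z) \<le> indicator S z * (4 * C)" for n
    proof (intro AE_I2)
      fix z
      have ln: "1 / 2 \<le> \<bar>ln (X (eps n) z)\<bar>" using X_bounds(4)[OF eps(1,2), of n z] by linarith
      have "\<bar>2 / ln (X (eps n) z)\<bar> \<le> 4"
        using ln divide_left_mono[OF ln, of 2] by (simp add: abs_divide)
      then have "\<bar>2 / ln (X (eps n) z)\<bar> * \<bar>?\<phi>' z\<bar> \<le> 4 * C" if "z \<in> S"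
        using C(2)[OF that] by (intro mult_mono) auto
      then show "norm (2 / ln (X (eps n) z) * ?\<phi>' z) \<le> indicator S z * (4 * C)"
        using out(2)[of z] by (cases "z \<in> S") (auto simp: abs_mult)
    qed
  qed measurable
  have lim2: "(\<lambda>n. LINT z|lborel. ?B (eps n) z * \<phi> z) \<longlonglongrightarrow> (LINT z|lborel. - G c z * \<phi> z)"
  proof (rule integral_dominated_convergence[where w="\<lambda>z. indicator S z * Q z * (72 * C)"])
    show "integrable lborel (\<lambda>z. indicator S z * Q z * (72 * C))"
      by (intro integrable_mult_left Q_integrable S)
    \<comment> \<open>At a zero the factor \<open>cnj (f z)\<close> makes every term 0, in agreement
      with \<open>G c z = 0\<close>.\<close>
    have "(\<lambda>n. ?B (eps n) z) \<longlonglongrightarrow> - G c z" for z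
    proof (cases "f z = 0")
      case False
      have "ln (cmod (f z)) \<noteq> 0" using ln_f[OF False] by linarith
      then have "(\<lambda>n. ?B (eps n) z) \<longlonglongrightarrow> 4 * Re (cnj (f z) * (c * g z)) / ((cmod (f z))\<^sup>2 * (2 * ln (cmod (f z)))\<^sup>2)"
        using False by (intro tendsto_intros X_eps_tendsto ln_X_eps_tendsto) auto
      moreover have "4 * Re (cnj (f z) * (c * g z)) / ((cmod (f z))\<^sup>2 * (2 * ln (cmod (f z)))\<^sup>2) = - G c z"
      proof -
        have "c * g z / f z = (cnj (f z) * (c * g z)) / of_real ((cmod (f z))\<^sup>2)"
          using complex_div_cnj[of "c * g z" "f z"] by (simp add: mult.commute)
        then have "Re (c * g z / f z) = Re (cnj (f z) * (c * g z)) / (cmod (f z))\<^sup>2"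
          by (simp only: Re_divide_of_real)
        moreover have "4 * k / (a * (2 * l)\<^sup>2) = k / a / l\<^sup>2" for k a l :: real
          by (simp add: power_mult_distrib)
        ultimately show ?thesis unfolding G_def by (simp only: minus_minus)
      qed
      ultimately show ?thesis by simp
    qed (simp add: G_def)
    then show "AE z in lborel. (\<lambda>n. ?B (eps n) z * \<phi> z) \<longlonglongrightarrow> - G c z * \<phi> z"
      by (intro AE_I2 tendsto_mult tendsto_const)
    show "AE z in lborel. norm (?B (eps n) z * \<phi> z) \<le> indicator S z * Q z * (72 * C)" for n
    proof (intro AE_I2)
      fix z
      have "\<bar>?B (eps n) z\<bar> * \<bar>\<phi> z\<bar> \<le> (72 * Q z) * C" if "z \<in> S"
        using C(1)[OF that] G_approx_bound[OF c(2) eps(1)[of n] eps(2)[of n], of z] Q_nonneg[of z] by (intro mult_mono) auto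
      then show "norm (?B (eps n) z * \<phi> z) \<le> indicator S z * Q z * (72 * C)"
        using out(1)[of z] unfolding real_norm_def abs_mult[of "?B (eps n) z"] by (cases "z \<in> S") auto
    qed
  qed measurable
  have "(LINT z|lborel. v z * ?\<phi>' z) = (LINT z|lborel. - G c z * \<phi> z)"
    using lim1 lim2 approx_weak_derivative[OF \<phi> eps(1,2) c(1)] LIMSEQ_unique by simp
  then show ?thesis by simp
qed

lemma v_Lp_loc:
  assumes "p \<noteq> \<infinity>"
  shows "v \<in> Lp_loc p U"
proof (rule Lp_locI)
  fix S assume S: "compact S" "S \<subseteq> U"
  have [measurable]: "S \<in> sets borel" using S by (auto intro: borel_compact)
  show "integrable lborel (\<lambda>x. indicator S x * \<bar>v x\<bar> powr enn2real p)"
  proof (rule Bochner_Integration.integrable_bound)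
    show "integrable lborel (\<lambda>x. indicator S x * 2 powr enn2real p)"
      using S by (intro integrable_mult_left) (auto intro: emeasure_compact_finite)
  qed (auto simp: indicator_def v_bound intro!: powr_mono2)
qed (use assms open_U in auto)

lemma G_Lp_loc:
  assumes "cmod c = 1"
  shows "G c \<in> Lp_loc 1 U" "G c \<in> Lp_loc 2 U"
proof -
  show "G c \<in> Lp_loc 1 U"
  proof (rule Lp_locI)
    fix S assume S: "compact S" "S \<subseteq> U"
    have [measurable]: "S \<in> sets borel" using S by (auto intro: borel_compact)
    show "integrable lborel (\<lambda>x. indicator S x * \<bar>G c x\<bar> powr enn2real 1)"
    proof (rule Bochner_Integration.integrable_bound)
      show "integrable lborel (\<lambda>z. 20 * (indicator S z * Q z))"
        by (intro integrable_mult_right Q_integrable S)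
    qed (auto simp: indicator_def Q_nonneg G_bound[OF assms])
  qed (use open_U in auto)
  show "G c \<in> Lp_loc 2 U"
  proof (rule Lp_locI)
    fix S assume S: "compact S" "S \<subseteq> U"
    have [measurable]: "S \<in> sets borel" using S by (auto intro: borel_compact)
    have le: "\<bar>G c z\<bar> ^ 2 \<le> (20 * Q z) ^ 2" for z
      using G_bound[OF assms, of z] by (intro power_mono) auto
    show "integrable lborel (\<lambda>x. indicator S x * \<bar>G c x\<bar> powr enn2real 2)"
    proof (rule Bochner_Integration.integrable_bound)
      show "integrable lborel (\<lambda>z. 400 * (indicator S z * (Q z)\<^sup>2))"
        by (intro integrable_mult_right Q_square_integrable S)
    qed (use le in \<open>auto simp: indicator_def power_mult_distrib\<close>)
  qed (use open_U in auto)
qed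

lemma v_weak_partial:
  assumes c: "axis i c \<in> Basis" "cmod c = 1"
  shows "has_weak_partial U (axis i c) v (G c)"
  unfolding has_weak_partial_def
proof (intro conjI ballI G_Lp_loc c v_Lp_loc)
  fix \<phi> assume \<phi>: "\<phi> \<in> test_functions U"
  obtain S where S: "compact S" "S \<subseteq> U" and out: "\<And>x. x \<notin> S \<Longrightarrow> \<phi> x = 0"
    "\<And>x b. x \<notin> S \<Longrightarrow> frechet_derivative \<phi> (at x) b = 0"
    and cont: "continuous_on UNIV \<phi>" "continuous_on UNIV (\<lambda>x. frechet_derivative \<phi> (at x) (axis i c))"
    using test_function_props[OF \<phi>] c by metis
  have [measurable]: "\<phi> \<in> borel_measurable borel"
      "(\<lambda>z. frechet_derivative \<phi> (at z) (axis i c)) \<in> borel_measurable borel"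
    using cont by (auto intro: borel_measurable_continuous_onI)
  have "(LINT x|lebesgue_on U. v x * frechet_derivative \<phi> (at x) (axis i c))
      = (LINT x|lborel. v x * frechet_derivative \<phi> (at x) (axis i c))"
    using out S open_U by (intro integral_lebesgue_on_eq_lborel) auto
  moreover have "(LINT x|lebesgue_on U. G c x * \<phi> x) = (LINT x|lborel. G c x * \<phi> x)"
    using out S open_U by (intro integral_lebesgue_on_eq_lborel) auto
  ultimately show "(LINT x|lebesgue_on U. v x * frechet_derivative \<phi> (at x) (axis i c)) =
      - (LINT x|lebesgue_on U. G c x * \<phi> x)"
    using weak_derivative_lborel[OF \<phi> c] by simp
qed simp

end

section \<open>Almost everywhere uniqueness for Lebesgue measurable weak derivatives\<close>

lemma Lp_loc_1_integrable:
  fixes g :: "'a::euclidean_space \<Rightarrow> real"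
  assumes g: "g \<in> Lp_loc 1 U" and S: "compact S" "S \<subseteq> U"
  shows "integrable lebesgue (\<lambda>x. indicator S x * g x)"
proof -
  have Sm: "S \<in> sets lebesgue" using S(1) by (simp add: lmeasurable_compact fmeasurableD)
  have "g \<in> borel_measurable (lebesgue_on U)" using g by (simp add: Lp_loc_def)
  then have meas: "g \<in> borel_measurable (lebesgue_on S)" by (rule measurable_restrict_mono[OF _ S(2)])
  have "integrable (lebesgue_on S) (\<lambda>x. \<bar>g x\<bar>)"
    using g S by (simp add: Lp_loc_def)
  then have "integrable (lebesgue_on S) g"
    by (rule Bochner_Integration.integrable_bound[OF _ meas]) simp
  then show ?thesis using Sm by (subst (asm) integrable_restrict_space) auto
qed

lemma integrable_times_test_function:
  fixes g :: "'a::euclidean_space \<Rightarrow> real"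
  assumes "open U" "g \<in> Lp_loc 1 U" "\<phi> \<in> test_functions U"
  shows "integrable (lebesgue_on U) (\<lambda>x. g x * \<phi> x)"
proof -
  obtain S where S: "compact S" "S \<subseteq> U" "\<And>x. x \<notin> S \<Longrightarrow> \<phi> x = 0" "continuous_on UNIV \<phi>"
    using test_function_props[OF assms(3)] by metis
  have "bounded (\<phi> ` S)"
    using S by (auto intro!: compact_imp_bounded compact_continuous_image continuous_on_subset[OF _ subset_UNIV])
  then obtain C where C: "\<And>x. x \<in> S \<Longrightarrow> \<bar>\<phi> x\<bar> \<le> C" by (auto simp: bounded_iff)
  have int: "integrable lebesgue (\<lambda>x. indicator S x * g x)"
    by (rule Lp_loc_1_integrable[OF assms(2) S(1,2)])
  have "integrable lebesgue (\<lambda>x. (indicator S x * g x) * \<phi> x)"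
  proof (rule Bochner_Integration.integrable_bound)
    show "integrable lebesgue (\<lambda>x. C * (indicator S x * g x))" using int by (rule integrable_mult_right)
    show "AE x in lebesgue. norm ((indicator S x * g x) * \<phi> x) \<le> norm (C * (indicator S x * g x))"
    proof (intro AE_I2)
      fix x
      have "\<bar>g x\<bar> * \<bar>\<phi> x\<bar> \<le> \<bar>g x\<bar> * \<bar>C\<bar>" if "x \<in> S"
        using C[OF that] by (intro mult_left_mono) linarith+
      then show "norm ((indicator S x * g x) * \<phi> x) \<le> norm (C * (indicator S x * g x))"
        by (auto simp: indicator_def abs_mult mult.commute)
    qed
    have "\<phi> \<in> borel_measurable lebesgue"
      using S(4) by (intro measurable_completion) (simp add: borel_measurable_continuous_onI)
    then show "(\<lambda>x. (indicator S x * g x) * \<phi> x) \<in> borel_measurable lebesgue"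
      by (rule borel_measurable_times[OF borel_measurable_integrable[OF int]])
  qed
  moreover have "(\<lambda>x. (indicator S x * g x) * \<phi> x) = (\<lambda>x. indicator U x *\<^sub>R (g x * \<phi> x))"
    using S(2,3) by (auto simp: fun_eq_iff indicator_def)
  ultimately show ?thesis using assms(1) by (subst integrable_restrict_space) auto
qed

text \<open>Weak derivatives are Lebesgue measurable, while \<open>AE_0_if_test_integrals_0\<close>
  works over \<open>lborel\<close>. Their difference is therefore replaced by a Borel function
  \<open>h'\<close> equal to it almost everywhere.\<close>

lemma weak_partial_unique:
  fixes u :: "'a::euclidean_space \<Rightarrow> real"
  assumes U: "open U" and g1: "has_weak_partial U b u g1" and g2: "has_weak_partial U b u g2"
  shows "AE x in lebesgue. x \<in> U \<longrightarrow> g1 x = g2 x"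
proof -
  have L: "g1 \<in> Lp_loc 1 U" "g2 \<in> Lp_loc 1 U" using g1 g2 by (auto simp: has_weak_partial_def)
  define h where "h x = indicator U x *\<^sub>R (g1 x - g2 x)" for x
  have "(\<lambda>x. g1 x - g2 x) \<in> borel_measurable (lebesgue_on U)"
    using L by (auto simp: Lp_loc_def)
  then have hm: "h \<in> borel_measurable lebesgue"
    unfolding h_def using U by (subst (asm) borel_measurable_restrict_space_iff) (auto simp: mult.commute)
  obtain h' where h': "h' \<in> borel_measurable lborel" "AE x in lborel. h x = h' x"
    using completion_ex_borel_measurable_real[OF hm] by blast
  have ae: "AE x in lebesgue. h x = h' x" using h'(2) by (rule AE_completion)
  have h'm: "h' \<in> borel_measurable lebesgue" using h'(1) by (rule measurable_completion)
  have "AE x in lborel. x \<in> U \<longrightarrow> h' x = 0"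
  proof (rule AE_0_if_test_integrals_0[OF U])
    fix l r assume lr: "cbox l r \<subseteq> U"
    have "integrable lebesgue (\<lambda>x. indicator (cbox l r) x * g1 x - indicator (cbox l r) x * g2 x)"
      using lr by (intro Bochner_Integration.integrable_diff Lp_loc_1_integrable[where U=U] L) auto
    moreover have "(\<lambda>x. indicator (cbox l r) x * g1 x - indicator (cbox l r) x * g2 x) = (\<lambda>x. indicator (cbox l r) x * h x)"
      using lr by (auto simp: fun_eq_iff h_def indicator_def)
    ultimately have int: "integrable lebesgue (\<lambda>x. indicator (cbox l r) x * h x)" by simp
    have "integrable lebesgue (\<lambda>x. indicator (cbox l r) x * h' x)"
    proof (rule integrable_cong_AE_imp[OF int])
      show "(\<lambda>x. indicator (cbox l r) x * h' x) \<in> borel_measurable lebesgue"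
        using h'm by (intro borel_measurable_times borel_measurable_indicator) auto
      show "AE x in lebesgue. indicator (cbox l r) x * h x = indicator (cbox l r) x * h' x"
        using ae by eventually_elim simp
    qed
    then show "integrable lborel (\<lambda>x. indicator (cbox l r) x * h' x)"
      using h'(1) by (subst (asm) integrable_completion) auto
  next
    fix \<phi> assume \<phi>: "\<phi> \<in> test_functions U"
    obtain S where S: "S \<subseteq> U" "\<And>x. x \<notin> S \<Longrightarrow> \<phi> x = 0" "continuous_on UNIV \<phi>"
      using test_function_props[OF \<phi>] by metis
    have \<phi>b: "\<phi> \<in> borel_measurable borel" using S(3) by (rule borel_measurable_continuous_onI)
    then have \<phi>m: "\<phi> \<in> borel_measurable lebesgue" by (intro measurable_completion) simp
    have "(LINT x|lborel. h' x * \<phi> x) = (LINT x|lebesgue. h' x * \<phi> x)"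
      using h'(1) \<phi>b by (intro integral_completion[symmetric]) auto
    also have "\<dots> = (LINT x|lebesgue. h x * \<phi> x)"
    proof (rule integral_cong_AE)
      show "AE x in lebesgue. h' x * \<phi> x = h x * \<phi> x" using ae by eventually_elim simp
    qed (intro borel_measurable_times h'm hm \<phi>m)+
    also have "\<dots> = (LINT x|lebesgue_on U. g1 x * \<phi> x - g2 x * \<phi> x)"
      using U by (subst integral_restrict_space) (auto simp: h_def algebra_simps)
    also have "\<dots> = (LINT x|lebesgue_on U. g1 x * \<phi> x) - (LINT x|lebesgue_on U. g2 x * \<phi> x)"
      by (intro Bochner_Integration.integral_diff integrable_times_test_function U L \<phi>)
    also have "\<dots> = 0" using g1 g2 \<phi> by (auto simp: has_weak_partial_def)
    finally show "(LINT x|lborel. h' x * \<phi> x) = 0" .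
  qed
  then have "AE x in lebesgue. x \<in> U \<longrightarrow> h' x = 0" by (rule AE_completion)
  then show ?thesis using ae by eventually_elim (auto simp: h_def)
qed

subsection \<open>Zeros of holomorphic functions\<close>

lemma open_vimage_line: "open S \<Longrightarrow> open {t. z + t *s w \<in> S}" for w :: "complex ^ 'n"
proof -
  assume "open S"
  have "bounded_linear (\<lambda>t. t *s w)"
    by (rule bounded_linear_intro[where K="norm w"])
      (auto simp: vec_eq_iff algebra_simps norm_vector_smult)
  then have "continuous_on UNIV (\<lambda>t. z + t *s w)"
    by (intro continuous_intros linear_continuous_on)
  then have "open ((\<lambda>t. z + t *s w) -` S)" using \<open>open S\<close> by (rule open_vimage[rotated])
  then show ?thesis by (simp add: vimage_def)
qed

lemma convex_vimage_line: "convex {t. z + t *s w \<in> ball x r}" for w :: "complex ^ 'n"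
proof -
  have "linear (\<lambda>t. t *s w)"
    by (rule linearI) (auto simp: vec_eq_iff algebra_simps)
  then have "convex ((\<lambda>t. t *s w) -` ball (x - z) r)" by (intro convex_linear_vimage) auto
  moreover have "(\<lambda>t. t *s w) -` ball (x - z) r = {t. z + t *s w \<in> ball x r}"
    by (auto simp: dist_norm algebra_simps)
  ultimately show ?thesis by simp
qed

lemma holomorphic_vec_line:
  assumes "open U" "holomorphic_vec_on f U" "\<And>t. t \<in> T \<Longrightarrow> z + t *s w \<in> U"
  shows "(\<lambda>t. f (z + t *s w)) holomorphic_on T"
  unfolding holomorphic_on_def field_differentiable_def
  using holomorphic_vec_line_deriv[OF assms(1,2) assms(3)] has_field_derivative_at_within by fastforce

text \<open>The interior \<open>T\<close> of the zero set is closed in \<open>U\<close>: a ball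
  around a point of \<open>closure T\<close> in \<open>U\<close> contains some
  \<open>y \<in> T\<close>, and the one-variable identity theorem on the complex line from
  \<open>y\<close> to any \<open>w\<close> in the ball gives \<open>f w = 0\<close>. Connectedness
  of \<open>U\<close> concludes.\<close>

lemma holomorphic_vec_identity:
  fixes f :: "complex ^ 'n \<Rightarrow> complex"
  assumes U: "open U" "connected U" and hol: "holomorphic_vec_on f U"
    and W: "open W" "W \<subseteq> U" "W \<noteq> {}" "\<And>z. z \<in> W \<Longrightarrow> f z = 0"
    and z: "z \<in> U"
  shows "f z = 0"
proof -
  define T where "T = interior {z \<in> U. f z = 0}"
  have T: "open T" "T \<subseteq> U" "\<And>z. z \<in> T \<Longrightarrow> f z = 0"
    using interior_subset[of "{z \<in> U. f z = 0}"] by (auto simp: T_def)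
  have "x \<in> T" if x: "x \<in> U" "x \<in> closure T" for x
  proof -
    obtain r where r: "r > 0" "ball x r \<subseteq> U" using U x by (auto simp: open_contains_ball)
    obtain y where y: "y \<in> T" "y \<in> ball x r" 
      using x(2) r(1) by (metis closure_approachable dist_commute mem_ball)
    have "f w = 0" if w: "w \<in> ball x r" for w
    proof -
      \<comment> \<open>The line meets the ball in a convex, hence connected, set of parameters;
        \<open>P\<close> is its open part over \<open>T\<close> and contains 0.\<close>
      define R where "R = {t. y + t *s (w - y) \<in> ball x r}"
      define P where "P = R \<inter> {t. y + t *s (w - y) \<in> T}"
      have "f (y + 1 *s (w - y)) = (\<lambda>_. 0) 1"
      proof (rule analytic_continuation_open[of P R "\<lambda>t. f (y + t *s (w - y))" "\<lambda>_. 0" 1])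
        show "open P" "open R" unfolding P_def R_def by (intro open_Int open_vimage_line T open_ball)+
        have "0 \<in> P" using y by (simp add: P_def R_def)
        then show "P \<noteq> {}" by blast
        show "connected R" unfolding R_def by (intro convex_connected convex_vimage_line)
        show "(\<lambda>t. f (y + t *s (w - y))) holomorphic_on R"
          using r by (intro holomorphic_vec_line[OF U(1) hol]) (auto simp: R_def)
      qed (use w T in \<open>auto simp: P_def R_def\<close>)
      then show ?thesis by simp
    qed
    then have "ball x r \<subseteq> {z \<in> U. f z = 0}" using r by auto
    then have "ball x r \<subseteq> T" unfolding T_def by (intro interior_maximal) auto
    then show ?thesis using r by auto
  qed
  then have "closedin (top_of_set U) T"
    using T by (auto simp: closedin_closed intro!: exI[of _ "closure T"] closure_subset[THEN subsetD])
  moreover have "openin (top_of_set U) T" using T U by (simp add: open_subset)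
  ultimately have "T = {} \<or> T = U" using U(2) by (auto simp: connected_clopen)
  moreover have "W \<subseteq> T" unfolding T_def by (intro interior_maximal W) (use W in auto)
  ultimately show ?thesis using W z T by auto
qed

text \<open>
  Change the coordinates of a zero one at a time into those of a nearby point where \<open>f\<close> is
  nonzero; the first step leaving the zero set supplies \<open>a\<close>, \<open>i\<close> and \<open>s\<close>.
\<close>

lemma zero_nonconstant_along_axis:
  fixes f :: "complex ^ 'n \<Rightarrow> complex"
  assumes U: "open U" "connected U" and hol: "holomorphic_vec_on f U"
    and z0: "z0 \<in> U" "f z0 = 0" and z1: "z1 \<in> U" "f z1 \<noteq> 0"
  obtains a i s x r where "ball x r \<subseteq> U" "a \<in> ball x r" "f a = 0" "a + axis i s \<in> ball x r" "f (a + axis i s) \<noteq> 0"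
proof -
  obtain r where r: "r > 0" "ball z0 r \<subseteq> U" using U z0 by (auto simp: open_contains_ball)
  obtain w where w: "w \<in> ball z0 r" "f w \<noteq> 0"
    using holomorphic_vec_identity[OF U hol open_ball r(2) _ _ z1(1)] z1 r by force
  define h where "h A = (\<chi> j. if j \<in> A then w $ j else z0 $ j)" for A
  \<comment> \<open>Each coordinate of \<open>h A - z0\<close> is that of \<open>w - z0\<close> or
    0, so all mixed points stay in the ball.\<close>
  have hb: "h A \<in> ball z0 r" for A
  proof -
    have "norm (h A - z0) \<le> norm (w - z0)"
      by (rule norm_le_componentwise_cart) (auto simp: h_def)
    then show ?thesis using w by (auto simp: dist_norm norm_minus_commute)
  qed
  have "\<exists>A i. i \<notin> A \<and> f (h A) = 0 \<and> f (h (insert i A)) \<noteq> 0"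
  proof (rule ccontr)
    assume *: "\<not> ?thesis"
    have "finite A \<Longrightarrow> f (h A) = 0" for A
    proof (induction A rule: finite_induct)
      case empty
      have "h {} = z0" by (simp add: h_def)
      then show ?case using z0 by simp
    next
      case (insert i A)
      then show ?case using * by blast
    qed
    then have "f (h UNIV) = 0" by simp
    then show False using w by (simp add: h_def)
  qed
  then obtain A i where Ai: "i \<notin> A" "f (h A) = 0" "f (h (insert i A)) \<noteq> 0" by blast
  have "h (insert i A) = h A + axis i (w $ i - z0 $ i)"
    using Ai(1) by (auto simp: h_def vec_eq_iff axis_def)
  then show thesis using that[OF r(2) hb Ai(2), of i "w $ i - z0 $ i"] Ai hb by metis
qed

subsection \<open>Failure of higher integrability\<close>

text \<open>The inverse square is scale invariant in the plane: on a ball of radius \<open>r\<close>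
  around \<open>\<xi>\<close> it is at least \<open>1 / r\<^sup>2\<close>, and the area is
  proportional to \<open>r\<^sup>2\<close>, so each small ball has mass at least the area of the
  unit disc. If the integral were finite, these masses would tend to the mass of a point, which is
  0.\<close>

lemma nn_integral_inverse_square_ball:
  fixes h :: "complex \<Rightarrow> ennreal"
  assumes [measurable]: "h \<in> borel_measurable borel" and d: "d > 0" "ball \<xi> d \<subseteq> S" and [measurable]: "S \<in> sets borel"
    and h: "\<And>w. w \<in> ball \<xi> d \<Longrightarrow> w \<noteq> \<xi> \<Longrightarrow> ennreal (1 / (cmod (w - \<xi>))\<^sup>2) \<le> h w"
  shows "(\<integral>\<^sup>+w. h w * indicator S w \<partial>lborel) = \<infinity>"
proof (rule ccontr)
  assume "(\<integral>\<^sup>+w. h w * indicator S w \<partial>lborel) \<noteq> \<infinity>"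
  then have fin: "(\<integral>\<^sup>+w. h w * indicator S w \<partial>lborel) < \<infinity>" by (simp add: less_top)
  define N where "N = density lborel h"
  have N: "emeasure N A = (\<integral>\<^sup>+w. h w * indicator A w \<partial>lborel)" if "A \<in> sets borel" for A
    unfolding N_def using that by (intro emeasure_density) auto
  define A where "A k = ball \<xi> (d / real (Suc k))" for k
  have Ak: "A k \<subseteq> ball \<xi> d" for k
    unfolding A_def using d by (intro subset_ball) (simp add: field_simps)
  have lower: "emeasure lborel (ball (0::complex) 1) \<le> emeasure N (A k)" for k
  proof -
    define r where "r = d / real (Suc k)"
    have r: "r > 0" using d by (simp add: r_def)
    have "emeasure lborel (ball (0::complex) 1) = ennreal (unit_ball_vol 2)"
      by (simp add: emeasure_ball)
    also have "\<dots> = ennreal (1 / r\<^sup>2) * emeasure lborel (ball \<xi> r)"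
      using r by (simp add: emeasure_ball ennreal_mult[symmetric])
    also have "\<dots> = (\<integral>\<^sup>+w. ennreal (1 / r\<^sup>2) * indicator (ball \<xi> r) w \<partial>lborel)"
      by (subst nn_integral_cmult_indicator) auto
    also have "\<dots> \<le> (\<integral>\<^sup>+w. h w * indicator (A k) w \<partial>lborel)"
    proof (rule nn_integral_mono_AE)
      show "AE w in lborel. ennreal (1 / r\<^sup>2) * indicator (ball \<xi> r) w \<le> h w * indicator (A k) w"
        using AE_lborel_singleton[of \<xi>]
      proof eventually_elim
        case (elim w)
        show ?case
        proof (cases "w \<in> ball \<xi> r")
          case True
          then have "1 / r\<^sup>2 \<le> 1 / (cmod (w - \<xi>))\<^sup>2"
            using elim by (intro divide_left_mono power_mono) (auto simp: dist_norm norm_minus_commute r intro!: mult_pos_pos)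
          then have "ennreal (1 / r\<^sup>2) \<le> h w"
            using h[of w] elim True Ak[of k] unfolding A_def r_def[symmetric]
            by (meson ennreal_leI order_trans subsetD)
          then show ?thesis using True by (simp add: A_def r_def)
        qed (simp add: A_def r_def)
      qed
    qed
    also have "\<dots> = emeasure N (A k)" by (simp add: N A_def)
    finally show ?thesis .
  qed
  have "(\<lambda>k. emeasure N (A k)) \<longlonglongrightarrow> emeasure N (\<Inter>k. A k)"
  proof (rule Lim_emeasure_decseq)
    show "range A \<subseteq> sets N" by (auto simp: N_def A_def)
    show "decseq A"
      unfolding A_def decseq_def using d by (auto intro!: subset_ball divide_left_mono)
    show "emeasure N (A k) \<noteq> \<infinity>" for k
    proof -
      have "emeasure N (A k) = (\<integral>\<^sup>+w. h w * indicator (A k) w \<partial>lborel)"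
        by (simp add: N A_def)
      also have "\<dots> \<le> (\<integral>\<^sup>+w. h w * indicator S w \<partial>lborel)"
        using Ak[of k] d by (intro nn_integral_mono) (auto simp: indicator_def)
      finally have "emeasure N (A k) \<le> (\<integral>\<^sup>+w. h w * indicator S w \<partial>lborel)" .
      then show ?thesis using fin by auto
    qed
  qed
  moreover have "emeasure N (\<Inter>k. A k) = 0"
  proof -
    have "(\<Inter>k. A k) = {\<xi>}"
    proof (intro equalityI subsetI)
      fix w assume w: "w \<in> (\<Inter>k. A k)"
      show "w \<in> {\<xi>}"
      proof (rule ccontr)
        assume "w \<notin> {\<xi>}"
        then have dist: "dist \<xi> w > 0" by simp
        then obtain k :: nat where "d < real k * dist \<xi> w"
          using reals_Archimedean3 by blast
        moreover have "real k * dist \<xi> w < real (Suc k) * dist \<xi> w"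
          using dist by (intro mult_strict_right_mono) auto
        ultimately have "d < dist \<xi> w * real (Suc k)"
          by (simp only: mult.commute)
        then have "d / real (Suc k) < dist \<xi> w"
          by (subst pos_divide_less_eq) auto
        moreover have "dist \<xi> w < d / real (Suc k)" using w by (auto simp: A_def)
        ultimately show False by simp
      qed
    qed (use d in \<open>auto simp: A_def\<close>)
    moreover have "emeasure N {\<xi>} = 0"
      by (subst N) (auto simp: nn_integral_0_iff_AE intro: eventually_mono[OF AE_lborel_singleton[of \<xi>]])
    ultimately show ?thesis by simp
  qed
  ultimately have "(\<lambda>k. emeasure N (A k)) \<longlonglongrightarrow> 0" by simp
  then have "emeasure lborel (ball (0::complex) 1) \<le> 0"
    by (rule LIMSEQ_le_const) (use lower in auto)
  then show False by (simp add: emeasure_ball unit_ball_vol_2)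
qed

text \<open>Near a zero of any order \<open>m\<close>, \<open>H'/H\<close> has a simple pole, while
  \<open>ln |H|\<close> grows only like \<open>m\<close> times the logarithm of the distance. For
  \<open>p > 2\<close> the power beats the logarithms.\<close>

lemma log_derivative_not_integrable:
  fixes H H' :: "complex \<Rightarrow> complex" and p :: real
  assumes S: "open S" "connected S" and hol: "H holomorphic_on S"
    and H': "\<And>t. t \<in> S \<Longrightarrow> (H has_field_derivative H' t) (at t)"
    and xi: "\<xi> \<in> S" "H \<xi> = 0" and nonconst: "\<not> H constant_on S"
    and small: "\<And>t. t \<in> S \<Longrightarrow> cmod (H t) < 1 / 2" and p: "p > 2"
    and meas: "(\<lambda>t. ennreal ((cmod (H' t) / (cmod (H t) * (ln (cmod (H t)))\<^sup>2)) powr p)) \<in> borel_measurable borel"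
  shows "(\<integral>\<^sup>+t. ennreal ((cmod (H' t) / (cmod (H t) * (ln (cmod (H t)))\<^sup>2)) powr p) * indicator S t \<partial>lborel) = \<infinity>"
proof -
  obtain k \<rho> m where k: "0 < m" "0 < \<rho>" "ball \<xi> \<rho> \<subseteq> S" "k holomorphic_on ball \<xi> \<rho>"
    "\<And>w. w \<in> ball \<xi> \<rho> \<Longrightarrow> H w = (w - \<xi>) ^ m * k w" "\<And>w. w \<in> ball \<xi> \<rho> \<Longrightarrow> k w \<noteq> 0"
    using holomorphic_factor_zero_nonconstant[OF hol S xi nonconst] by metis
  define L where "L w = deriv k w / k w" for w
  have sub: "cball \<xi> (\<rho> / 2) \<subseteq> ball \<xi> \<rho>" using k(2) by auto
  have contL: "continuous_on (cball \<xi> (\<rho> / 2)) L" and contk: "continuous_on (cball \<xi> (\<rho> / 2)) k"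
  proof -
    have "L holomorphic_on ball \<xi> \<rho>"
      unfolding L_def using k by (intro holomorphic_intros holomorphic_deriv) auto
    then show "continuous_on (cball \<xi> (\<rho> / 2)) L" "continuous_on (cball \<xi> (\<rho> / 2)) k"
      using k(4) sub by (meson holomorphic_on_imp_continuous_on continuous_on_subset)+
  qed
  have "bounded (L ` cball \<xi> (\<rho> / 2))"
    by (intro compact_imp_bounded compact_continuous_image contL compact_cball)
  then obtain B where B: "B > 0" "\<And>w. w \<in> cball \<xi> (\<rho> / 2) \<Longrightarrow> cmod (L w) \<le> B"
    by (auto simp: bounded_pos)
  obtain w0 where w0: "w0 \<in> cball \<xi> (\<rho> / 2)" "\<And>w. w \<in> cball \<xi> (\<rho> / 2) \<Longrightarrow> cmod (k w0) \<le> cmod (k w)"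
    using continuous_attains_inf[OF compact_cball _ continuous_on_norm[OF contk]] k(2) by auto
  define c where "c = cmod (k w0)"
  have c: "c > 0" using k(6) w0(1) sub by (auto simp: c_def)
  \<comment> \<open>With \<open>x = cmod (w - \<xi>)\<close> and \<open>l\<close> the squared
    logarithm, \<open>(1 / (2 * x * l)) powr p \<ge> 1 / x\<^sup>2\<close> amounts to
    \<open>x powr (1 - 2 / p) * (2 * l) \<le> 1\<close>; the exponent is positive because
    \<open>p > 2\<close>.\<close>
  define a where "a = 1 - 2 / p"
  have a: "a > 0" using p by (simp add: a_def)
  have "((\<lambda>x. x powr a * (2 * (ln c + real m * ln x)\<^sup>2)) \<longlongrightarrow> 0) (at_right 0)"
    using a k(1) by real_asymp
  then have "\<forall>\<^sub>F x in at_right 0. x powr a * (2 * (ln c + real m * ln x)\<^sup>2) < 1"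
    by (rule order_tendstoD) simp
  then obtain d0 where d0: "d0 > 0" "\<And>x. 0 < x \<Longrightarrow> x < d0 \<Longrightarrow> x powr a * (2 * (ln c + real m * ln x)\<^sup>2) < 1"
    by (auto simp: eventually_at_right_field)
  \<comment> \<open>\<open>d0\<close> absorbs the logarithms, \<open>\<rho> / 2\<close> stays where
    \<open>L\<close> and \<open>k\<close> are controlled, and \<open>1 / (2 * B)\<close> makes
    \<open>L\<close> at most half of the pole term \<open>1 / x\<close>.\<close>
  define d where "d = min d0 (min (\<rho> / 2) (1 / (2 * B)))"
  have d: "d > 0" "d \<le> d0" "d \<le> \<rho> / 2" "d \<le> 1 / (2 * B)" using d0 k(2) B by (auto simp: d_def)
  show ?thesis
  proof (rule nn_integral_inverse_square_ball[OF meas d(1)])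
    show "ball \<xi> d \<subseteq> S" using d k by (auto intro: subset_trans[OF subset_ball])
    show "S \<in> sets borel" using S by simp
    fix w assume w: "w \<in> ball \<xi> d" "w \<noteq> \<xi>"
    define x where "x = cmod (w - \<xi>)"
    have x: "0 < x" "x < d" using w by (auto simp: x_def dist_norm norm_minus_commute)
    have w1: "w \<in> cball \<xi> (\<rho> / 2)" "w \<in> ball \<xi> \<rho>" "w \<in> S"
      using w d k(2,3) by auto
    have H0: "H w \<noteq> 0" using k(5,6) w1 w by auto
    have "((\<lambda>w. (w - \<xi>) ^ m * k w) has_field_derivative
        of_nat m * (w - \<xi>) ^ (m - 1) * k w + (w - \<xi>) ^ m * deriv k w) (at w)"
      using holomorphic_derivI[OF k(4) open_ball w1(2)] by (auto intro!: derivative_eq_intros)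
    then have "(H has_field_derivative of_nat m * (w - \<xi>) ^ (m - 1) * k w + (w - \<xi>) ^ m * deriv k w) (at w)"
      by (rule has_field_derivative_transform_within_open[of _ _ _ "ball \<xi> \<rho>"]) (use w1 k(5) in auto)
    then have "H' w = of_nat m * (w - \<xi>) ^ (m - 1) * k w + (w - \<xi>) ^ m * deriv k w"
      using H'[OF w1(3)] DERIV_unique by blast
    also have "\<dots> = H w * (of_nat m / (w - \<xi>) + L w)"
    proof -
      have pow: "(w - \<xi>) ^ m = (w - \<xi>) ^ (m - 1) * (w - \<xi>)" using k(1) by (simp add: power_eq_if)
      have "of_nat m * P * K + P * u * D = P * u * K * (of_nat m / u + D / K)" if "u \<noteq> 0" "K \<noteq> 0" for P u K D :: complex
        using that by (simp add: field_simps)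
      then show ?thesis using k(5,6)[OF w1(2)] w(2) unfolding L_def by (simp add: pow)
    qed
    finally have "cmod (H' w) = cmod (H w) * cmod (of_nat m / (w - \<xi>) + L w)" by (simp add: norm_mult)
    moreover have "cmod (of_nat m / (w - \<xi>) + L w) \<ge> 1 / (2 * x)"
    proof -
      have "cmod (of_nat m / (w - \<xi>) + L w) \<ge> cmod (of_nat m / (w - \<xi>)) - cmod (L w)"
        by (metis add_diff_cancel diff_add_cancel norm_diff_ineq norm_minus_commute)
      moreover have "cmod (of_nat m / (w - \<xi>)) \<ge> 1 / x"
        using k(1) x by (simp add: norm_divide x_def divide_right_mono)
      moreover have "cmod (L w) \<le> 1 / (2 * x)"
      proof -
        have "2 * (B * d) \<le> 1" using d(4) B(1) by (simp add: field_simps)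
        moreover have "B * x \<le> B * d" using x B(1) by (intro mult_left_mono) auto
        ultimately have "B * (2 * x) \<le> 1" by linarith
        then have "B \<le> 1 / (2 * x)" using x by (simp add: field_simps)
        then show ?thesis using B(2)[OF w1(1)] by linarith
      qed
      moreover have "1 / x = 1 / (2 * x) + 1 / (2 * x)" by (simp add: field_simps)
      ultimately show ?thesis by linarith
    qed
    ultimately have q: "1 / (2 * x) \<le> cmod (H' w) / cmod (H w)" using H0 by simp
    define l where "l = (ln (cmod (H w)))\<^sup>2"
    have l: "0 < l" "l \<le> (ln c + real m * ln x)\<^sup>2"
    proof -
      have "x ^ m * c \<le> cmod (H w)"
        using w0(2)[OF w1(1)] k(5)[OF w1(2)] by (simp add: x_def c_def norm_mult norm_power mult_left_mono)
      then have "ln (x ^ m * c) \<le> ln (cmod (H w))" using x c H0 by simp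
      then have 1: "ln c + real m * ln x \<le> ln (cmod (H w))" using x c by (simp add: ln_mult ln_realpow)
      have 2: "ln (cmod (H w)) \<le> - (1 / 2)" using H0 small[OF w1(3)] by (intro ln_le_minus_half) auto
      show "0 < l" using 2 by (simp add: l_def)
      \<comment> \<open>Both logarithmic terms are negative, so a lower bound on
        \<open>ln (cmod (H w))\<close> bounds its square from above; negating both sides makes
        \<open>power_mono\<close> applicable.\<close>
      have "(- ln (cmod (H w)))\<^sup>2 \<le> (- (ln c + real m * ln x))\<^sup>2"
        using 1 2 by (intro power_mono) linarith+
      then show "l \<le> (ln c + real m * ln x)\<^sup>2" by (simp only: l_def power2_minus)
    qed
    have "x powr a * (2 * l) \<le> 1"
    proof -
      have "x powr a * (2 * l) \<le> x powr a * (2 * (ln c + real m * ln x)\<^sup>2)"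
        using l by (intro mult_left_mono) auto
      then show ?thesis using d0(2)[of x] x d by linarith
    qed
    then have "x powr (- (2 / p)) \<le> 1 / (2 * x) / l"
    proof -
      have "x powr (- (2 / p)) * x = x powr a"
        using x by (simp add: a_def powr_diff powr_minus field_simps)
      then have "x powr (- (2 / p)) * (2 * x * l) = x powr a * (2 * l)" by (metis mult.assoc mult.left_commute)
      then have "x powr (- (2 / p)) * (2 * x * l) \<le> 1" using \<open>x powr a * (2 * l) \<le> 1\<close> by (simp only:)
      then show ?thesis using x l by (simp add: field_simps)
    qed
    also have "\<dots> \<le> cmod (H' w) / cmod (H w) / l" using q l by (intro divide_right_mono) auto
    finally have "(x powr (- (2 / p))) powr p \<le> (cmod (H' w) / (cmod (H w) * l)) powr p"
      using p by (intro powr_mono2) auto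
    moreover have "(x powr (- (2 / p))) powr p = 1 / x\<^sup>2"
    proof -
      have "(x powr (- (2 / p))) powr p = x powr (- 2)" unfolding powr_powr using p by simp
      also have "\<dots> = 1 / x\<^sup>2" using x by (simp add: powr_minus inverse_eq_divide)
      finally show ?thesis .
    qed
    ultimately show "ennreal (1 / (cmod (w - \<xi>))\<^sup>2) \<le> ennreal ((cmod (H' w) / (cmod (H w) * (ln (cmod (H w)))\<^sup>2)) powr p)"
      by (simp add: x_def l_def ennreal_leI)
  qed
qed

text \<open>
  Averaging over translates by \<open>e t\<close> replaces the decomposition of Lebesgue measure into
  slices along a complex line.
\<close>

lemma nn_integral_translates_le:
  fixes h :: "'a::euclidean_space \<Rightarrow> ennreal" and e :: "'b::euclidean_space \<Rightarrow> 'a"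
  assumes h: "h \<in> borel_measurable borel" and e: "continuous_on UNIV e"
    and A: "A \<in> sets borel" and B: "B \<in> sets borel" and C: "C \<in> sets borel"
    and sub: "\<And>z t. z \<in> A \<Longrightarrow> t \<in> B \<Longrightarrow> z + e t \<in> C"
  shows "(\<integral>\<^sup>+z. (\<integral>\<^sup>+t. h (z + e t) * indicator B t \<partial>lborel) * indicator A z \<partial>lborel)
    \<le> (\<integral>\<^sup>+z. h z * indicator C z \<partial>lborel) * emeasure lborel B"
proof -
  note [measurable] = h A B C borel_measurable_continuous_onI[OF e]
  have "(\<integral>\<^sup>+z. (\<integral>\<^sup>+t. h (z + e t) * indicator B t \<partial>lborel) * indicator A z \<partial>lborel)
      = (\<integral>\<^sup>+z. (\<integral>\<^sup>+t. h (z + e t) * indicator B t * indicator A z \<partial>lborel) \<partial>lborel)"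
    by (subst nn_integral_multc) auto
  also have "\<dots> = (\<integral>\<^sup>+t. (\<integral>\<^sup>+z. h (z + e t) * indicator B t * indicator A z \<partial>lborel) \<partial>lborel)"
    by (rule lborel_pair.Fubini') measurable
  also have "\<dots> \<le> (\<integral>\<^sup>+t. (\<integral>\<^sup>+z. h z * indicator C z \<partial>lborel) * indicator B t \<partial>lborel)"
  proof (rule nn_integral_mono)
    fix t :: 'b
    have "(\<integral>\<^sup>+z. h (z + e t) * indicator B t * indicator A z \<partial>lborel)
        \<le> (\<integral>\<^sup>+z. h (e t + z) * indicator C (e t + z) * indicator B t \<partial>lborel)"
      by (intro nn_integral_mono) (auto simp: indicator_def add.commute sub)
    also have "\<dots> = (\<integral>\<^sup>+z. h (e t + z) * indicator C (e t + z) \<partial>lborel) * indicator B t"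
      by (rule nn_integral_multc) measurable
    also have "(\<integral>\<^sup>+z. h (e t + z) * indicator C (e t + z) \<partial>lborel)
        = (\<integral>\<^sup>+z. h z * indicator C z \<partial>distr lborel borel ((+) (e t)))"
      by (subst nn_integral_distr) auto
    also have "\<dots> = (\<integral>\<^sup>+z. h z * indicator C z \<partial>lborel)" by (simp add: lborel_distr_plus)
    finally show "(\<integral>\<^sup>+z. h (z + e t) * indicator B t * indicator A z \<partial>lborel)
        \<le> (\<integral>\<^sup>+z. h z * indicator C z \<partial>lborel) * indicator B t" .
  qed
  also have "\<dots> = (\<integral>\<^sup>+z. h z * indicator C z \<partial>lborel) * emeasure lborel B"
    by (subst nn_integral_cmult_indicator) auto
  finally show ?thesis .
qed

section \<open>Slices of \<open>f\<close> near a zero\<close>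

context holomorphic_direction
begin

text \<open>The Euclidean norm of the pair \<open>G 1 z\<close>, \<open>G \<i> z\<close>, that is,
  the size of the gradient of \<open>v\<close> in the \<open>i\<close>-th complex coordinate, in the
  form treated by \<open>log_derivative_not_integrable\<close>.\<close>

definition T :: "complex ^ 'n \<Rightarrow> real"
  where "T z = cmod (g z) / (cmod (f z) * (ln (cmod (f z)))\<^sup>2)"

lemma T_measurable [measurable]: "T \<in> borel_measurable borel"
  unfolding T_def[abs_def] by measurable

lemma continuous_axis: "continuous_on UNIV (axis i :: complex \<Rightarrow> complex ^ 'n)"
proof -
  have "bounded_linear (axis i :: complex \<Rightarrow> complex ^ 'n)"
    by (rule bounded_linear_intro[where K=1]) (auto simp: axis_simps norm_axis)
  then show ?thesis by (rule linear_continuous_on)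
qed

text \<open>On a small circle around the isolated zero of the slice through \<open>a\<close>, |f|
  has a positive minimum \<open>m0\<close>. By uniform continuity a nearby slice stays above
  \<open>m0 / 2\<close> on the circle and below it at the centre, which forces a zero
  inside.\<close>

lemma nearby_slices_vanish:
  assumes ball: "ball x r \<subseteq> U" "a \<in> ball x r" "f a = 0" "a + axis i s \<in> ball x r" "f (a + axis i s) \<noteq> 0"
  obtains \<rho> \<delta> C where "\<rho> > 0" "\<delta> > 0" "compact C" "C \<subseteq> U"
    "\<And>z t. z \<in> ball a \<delta> \<Longrightarrow> t \<in> cball 0 \<rho> \<Longrightarrow> z + axis i t \<in> C"
    "\<And>z. z \<in> ball a \<delta> \<Longrightarrow> \<exists>t\<in>ball 0 \<rho>. f (z + axis i t) = 0"
    "\<And>z t. z \<in> ball a \<delta> \<Longrightarrow> cmod t = \<rho> \<Longrightarrow> f (z + axis i t) \<noteq> 0"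
proof -
  define R where "R = {t. a + axis i t \<in> ball x r}"
  define e1 :: "complex ^ 'n" where "e1 = axis i 1"
  have axis: "axis i t = t *s e1" for t
    using axis_simps(3)[of i t 1] by (simp only: mult_1_right e1_def)
  have "open R" "connected R"
    unfolding R_def axis by (intro open_vimage_line open_ball convex_connected convex_vimage_line)+
  moreover have "0 \<in> R" "s \<in> R" using ball(2,4) by (auto simp: R_def axis_simps)
  ultimately have R: "open R" "connected R" "0 \<in> R" "s \<in> R" by auto
  have hol: "(\<lambda>t. f (a + axis i t)) holomorphic_on R"
    unfolding holomorphic_on_def field_differentiable_def R_def
    using slice_deriv ball(1) has_field_derivative_at_within by blast
  have nonconst: "\<not> (\<lambda>t. f (a + axis i t)) constant_on R"
    using R(3,4) ball(3,5) unfolding constant_on_def by (metis add_0_right axis_simps(5))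
  obtain k \<rho>' m where k: "0 < m" "0 < \<rho>'" "ball 0 \<rho>' \<subseteq> R"
    "\<And>w. w \<in> ball 0 \<rho>' \<Longrightarrow> f (a + axis i w) = (w - 0) ^ m * k w" "\<And>w. w \<in> ball 0 \<rho>' \<Longrightarrow> k w \<noteq> 0"
  proof -
    have "f (a + axis i 0) = 0" using ball(3) by (simp add: axis_simps)
    from holomorphic_factor_zero_nonconstant[OF hol R(1,2,3) this nonconst] show thesis
      using that by metis
  qed
  \<comment> \<open>Halving the radius puts the closed disc inside the disc where the factorization
    leaves 0 as the only zero.\<close>
  define \<rho> where "\<rho> = \<rho>' / 2"
  have \<rho>: "\<rho> > 0" "cball 0 \<rho> \<subseteq> ball 0 \<rho>'" using k(2) by (auto simp: \<rho>_def)
  define C0 where "C0 = (\<lambda>t. a + axis i t) ` cball 0 \<rho>"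
  have C0: "compact C0" "C0 \<subseteq> U"
  proof -
    show "compact C0"
      unfolding C0_def by (intro compact_continuous_image continuous_intros continuous_on_subset[OF continuous_axis]) auto
    have "a + axis i t \<in> ball x r" if "t \<in> cball 0 \<rho>" for t
      using that \<rho>(2) k(3) unfolding R_def by blast
    then show "C0 \<subseteq> U" using ball(1) unfolding C0_def by blast
  qed
  obtain e where e: "e > 0" "(\<Union>x\<in>C0. cball x e) \<subseteq> U"
    using compact_subset_open_imp_cball_epsilon_subset[OF C0(1) open_U C0(2)] by blast
  \<comment> \<open>The closed \<open>e\<close>-neighbourhood of the disc \<open>C0\<close> is
    compact, lies in \<open>U\<close> and contains the parallel discs of all nearby slices.\<close>
  define C where "C = (\<lambda>(y, z). y + z) ` (C0 \<times> cball 0 e)"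
  have C: "compact C"
    unfolding C_def case_prod_unfold by (intro compact_continuous_image continuous_intros compact_Times C0 compact_cball)
  have CU: "C \<subseteq> U"
  proof
    fix z assume "z \<in> C"
    then obtain y w where "y \<in> C0" "norm w \<le> e" "z = y + w" by (auto simp: C_def)
    then have "z \<in> (\<Union>x\<in>C0. cball x e)" by (auto simp: dist_norm intro!: bexI[of _ y])
    then show "z \<in> U" using e by blast
  qed
  have inC: "z + axis i t \<in> C" if "z \<in> cball a e" "t \<in> cball 0 \<rho>" for z t
  proof -
    have "z + axis i t = (a + axis i t) + (z - a)" by simp
    moreover have "a + axis i t \<in> C0" "z - a \<in> cball 0 e" using that by (auto simp: C0_def dist_norm norm_minus_commute)
    ultimately show ?thesis unfolding C_def by (intro image_eqI[where x="(a + axis i t, z - a)"]) auto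
  qed
  have "continuous_on (sphere 0 \<rho>) (\<lambda>t. cmod (f (a + axis i t)))"
  proof (intro continuous_intros continuous_on_compose2[OF continuous_f])
    show "(\<lambda>t. a + axis i t) ` sphere 0 \<rho> \<subseteq> U" using C0(2) by (auto simp: C0_def)
  qed (auto intro: continuous_on_subset[OF continuous_axis])
  then obtain t0 where t0: "t0 \<in> sphere 0 \<rho>" "\<And>t. t \<in> sphere 0 \<rho> \<Longrightarrow> cmod (f (a + axis i t0)) \<le> cmod (f (a + axis i t))"
  proof -
    have "sphere (0::complex) \<rho> \<noteq> {}" using \<rho>(1) by (simp add: sphere_eq_empty)
    from continuous_attains_inf[OF compact_sphere this] that \<open>continuous_on (sphere 0 \<rho>) _\<close>
    show thesis by blast
  qed
  define m0 where "m0 = cmod (f (a + axis i t0))"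
  have m0: "m0 > 0"
  proof -
    have "t0 \<in> ball 0 \<rho>'" "t0 \<noteq> 0" using t0(1) \<rho>(1) subsetD[OF \<rho>(2), of t0] by auto
    then show ?thesis using k(4,5) by (simp add: m0_def)
  qed
  have "uniformly_continuous_on C f"
    by (intro compact_uniformly_continuous C continuous_on_subset[OF continuous_f CU])
  then obtain d where d: "d > 0" "\<And>y z. y \<in> C \<Longrightarrow> z \<in> C \<Longrightarrow> dist z y < d \<Longrightarrow> dist (f z) (f y) < m0 / 2"
    using m0 unfolding uniformly_continuous_on_def by (metis half_gt_zero)
  define \<delta> where "\<delta> = min d e"
  have close: "dist (f (z + axis i t)) (f (a + axis i t)) < m0 / 2" if "z \<in> ball a \<delta>" "t \<in> cball 0 \<rho>" for z t
    using that e(1) by (intro d(2) inC) (auto simp: \<delta>_def dist_commute)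
  have circle: "m0 / 2 < cmod (f (z + axis i t))" if "z \<in> ball a \<delta>" "cmod t = \<rho>" for z t
  proof -
    have "m0 \<le> cmod (f (a + axis i t))" using t0(2)[of t] that by (simp add: m0_def)
    also have "\<dots> \<le> cmod (f (z + axis i t)) + dist (f (z + axis i t)) (f (a + axis i t))"
      by (metis dist_norm norm_minus_commute norm_triangle_sub)
    finally show ?thesis using close[OF that(1), of t] that by simp
  qed
  show thesis
  proof
    show "\<rho> > 0" "\<delta> > 0" "compact C" "C \<subseteq> U" using \<rho> d e C CU by (auto simp: \<delta>_def)
    show "z + axis i t \<in> C" if "z \<in> ball a \<delta>" "t \<in> cball 0 \<rho>" for z t
      using that by (intro inC) (auto simp: \<delta>_def)
    show "f (z + axis i t) \<noteq> 0" if "z \<in> ball a \<delta>" "cmod t = \<rho>" for z t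
      using circle[OF that] m0 by auto
    show "\<exists>t\<in>ball 0 \<rho>. f (z + axis i t) = 0" if z: "z \<in> ball a \<delta>" for z
    proof -
      have zU: "z + axis i t \<in> U" if "t \<in> cball 0 \<rho>" for t
        using inC[OF _ that, of z] z CU by (auto simp: \<delta>_def)
      have hol: "(\<lambda>t. f (z + axis i t)) holomorphic_on cball 0 \<rho>"
        unfolding holomorphic_on_def field_differentiable_def
        using slice_deriv zU has_field_derivative_at_within by blast
      have small: "cmod (f (z + axis i 0)) < m0 / 2"
        using close[OF z, of 0] \<rho>(1) ball(3) by (simp add: axis_simps)
      show ?thesis
      proof (rule holomorphic_contract_to_zero[of 0 \<rho> "\<lambda>t. f (z + axis i t)"])
        show "cmod (f (z + axis i 0)) < cmod (f (z + axis i t))" if "norm (0 - t) = \<rho>" for t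
          using small circle[OF z, of t] that by simp
      qed (use hol \<rho>(1) in \<open>auto intro: holomorphic_on_imp_continuous_on holomorphic_on_subset\<close>)
    qed
  qed
qed

text \<open>A zero inside and none on the circle make the slice nonconstant on the open disc: a
  constant value 0 would pass to the closed disc by continuity.\<close>

lemma slice_integral_infinite:
  assumes p: "p > 2" and \<rho>: "\<rho> > 0" and zU: "\<And>t. t \<in> cball 0 \<rho> \<Longrightarrow> z + axis i t \<in> U"
    and zero: "\<xi> \<in> ball 0 \<rho>" "f (z + axis i \<xi>) = 0"
    and circle: "\<And>t. cmod t = \<rho> \<Longrightarrow> f (z + axis i t) \<noteq> 0"
  shows "(\<integral>\<^sup>+t. ennreal (T (z + axis i t) powr p) * indicator (ball 0 \<rho>) t \<partial>lborel) = \<infinity>"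
  unfolding T_def
proof (rule log_derivative_not_integrable[of "ball 0 \<rho>" "\<lambda>t. f (z + axis i t)" "\<lambda>t. g (z + axis i t)" \<xi>])
  have hol: "(\<lambda>t. f (z + axis i t)) holomorphic_on cball 0 \<rho>"
    unfolding holomorphic_on_def field_differentiable_def
    using slice_deriv zU has_field_derivative_at_within by blast
  then show "(\<lambda>t. f (z + axis i t)) holomorphic_on ball 0 \<rho>"
    by (rule holomorphic_on_subset) auto
  show "\<not> (\<lambda>t. f (z + axis i t)) constant_on ball 0 \<rho>"
  proof
    assume "(\<lambda>t. f (z + axis i t)) constant_on ball 0 \<rho>"
    then have c: "f (z + axis i t) = 0" if "t \<in> ball 0 \<rho>" for t
      using zero that unfolding constant_on_def by metis
    have "closure (ball 0 \<rho>) \<subseteq> {t \<in> cball 0 \<rho>. f (z + axis i t) = 0}"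
      using c \<rho> by (intro closure_minimal continuous_closed_preimage_constant holomorphic_on_imp_continuous_on hol) auto
    then have "f (z + axis i (of_real \<rho>)) = 0" using \<rho> by (auto simp: subset_iff)
    then show False using circle[of "of_real \<rho>"] \<rho> by simp
  qed
  note [measurable] = borel_measurable_continuous_onI[OF continuous_axis]
  show "(\<lambda>t. ennreal ((cmod (g (z + axis i t)) / (cmod (f (z + axis i t)) * (ln (cmod (f (z + axis i t))))\<^sup>2)) powr p)) \<in> borel_measurable borel"
    by measurable
qed (use zU less p zero in \<open>auto intro!: slice_deriv\<close>)

text \<open>Infinite slice integrals over a ball of positive measure make the averaged integral
  infinite. It is at most the integral over \<open>C\<close> times the finite area of a disc, so the
  integral over \<open>C\<close> must be infinite.\<close>

lemma T_powr_integral_infinite: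
  assumes p: "p > 2"
    and ball: "ball x r \<subseteq> U" "a \<in> ball x r" "f a = 0" "a + axis i s \<in> ball x r" "f (a + axis i s) \<noteq> 0"
  obtains C where "compact C" "C \<subseteq> U" "(\<integral>\<^sup>+z. ennreal (T z powr p) * indicator C z \<partial>lborel) = \<infinity>"
proof -
  obtain \<rho> \<delta> C where C: "\<rho> > 0" "\<delta> > 0" "compact C" "C \<subseteq> U"
    "\<And>z t. z \<in> ball a \<delta> \<Longrightarrow> t \<in> cball 0 \<rho> \<Longrightarrow> z + axis i t \<in> C"
    "\<And>z. z \<in> ball a \<delta> \<Longrightarrow> \<exists>t\<in>ball 0 \<rho>. f (z + axis i t) = 0"
    "\<And>z t. z \<in> ball a \<delta> \<Longrightarrow> cmod t = \<rho> \<Longrightarrow> f (z + axis i t) \<noteq> 0"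
    by (rule nearby_slices_vanish[OF ball]) blast
  let ?h = "\<lambda>z. ennreal (T z powr p)"
  have inner: "(\<integral>\<^sup>+t. ?h (z + axis i t) * indicator (ball 0 \<rho>) t \<partial>lborel) = \<infinity>" if z: "z \<in> ball a \<delta>" for z
  proof -
    obtain \<xi> where "\<xi> \<in> ball 0 \<rho>" "f (z + axis i \<xi>) = 0" using C(6)[OF z] by blast
    then show ?thesis
      using C(4,5,7) z by (intro slice_integral_infinite[OF p C(1)]) auto
  qed
  have "(\<integral>\<^sup>+z. (\<integral>\<^sup>+t. ?h (z + axis i t) * indicator (ball 0 \<rho>) t \<partial>lborel) * indicator (ball a \<delta>) z \<partial>lborel)
      = (\<integral>\<^sup>+z. \<infinity> * indicator (ball a \<delta>) z \<partial>lborel)"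
  proof (rule nn_integral_cong)
    fix z
    show "(\<integral>\<^sup>+t. ?h (z + axis i t) * indicator (ball 0 \<rho>) t \<partial>lborel) * indicator (ball a \<delta>) z = \<infinity> * indicator (ball a \<delta>) z"
      using inner[of z] by (simp only: indicator_def split: if_splits) simp
  qed
  also have "\<dots> = \<infinity> * emeasure lborel (ball a \<delta>)"
    by (subst nn_integral_cmult_indicator) auto
  also have "\<dots> = \<infinity>"
  proof -
    have "unit_ball_vol (real DIM(complex ^ 'n)) \<noteq> 0"
      by (rule less_imp_neq[symmetric], rule unit_ball_vol_pos) simp
    then have "emeasure lborel (ball a \<delta>) \<noteq> 0"
      using C(2) by (subst emeasure_ball) (auto simp del: DIM_cart)
    then show ?thesis by (simp add: ennreal_top_mult)
  qed
  finally have "\<infinity> \<le> (\<integral>\<^sup>+z. ?h z * indicator C z \<partial>lborel) * emeasure lborel (ball (0::complex) \<rho>)"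
    using nn_integral_translates_le[of ?h "axis i" "ball a \<delta>" "ball 0 \<rho>" C] C(3,5)
    by (simp add: continuous_axis borel_compact)
  moreover have "emeasure lborel (ball (0::complex) \<rho>) < \<infinity>" by (rule emeasure_lborel_ball_finite)
  ultimately have "\<not> (\<integral>\<^sup>+z. ?h z * indicator C z \<partial>lborel) < \<infinity>"
    by (metis ennreal_mult_less_top infinity_ennreal_def not_less)
  then have "(\<integral>\<^sup>+z. ?h z * indicator C z \<partial>lborel) = \<infinity>"
    by (simp add: not_less top_unique)
  then show thesis using that C(3,4) by blast
qed

text \<open>Returns from the modulus to the two real partials, the functions to which uniqueness of
  weak derivatives applies.\<close>

lemma T_powr_le:
  assumes "p > 0"
  shows "T z powr p \<le> 2 powr p * (\<bar>G 1 z\<bar> powr p + \<bar>G \<i> z\<bar> powr p)"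
proof -
  define u where "u = g z / f z"
  define l where "l = (ln (cmod (f z)))\<^sup>2"
  have "cmod u \<le> \<bar>Re u\<bar> + \<bar>Im u\<bar>" by (rule cmod_le)
  then have "cmod u / l \<le> (\<bar>Re u\<bar> + \<bar>Im u\<bar>) / l" by (rule divide_right_mono) (simp add: l_def)
  moreover have "T z = cmod u / l" by (simp add: T_def u_def l_def norm_divide)
  moreover have "\<bar>G 1 z\<bar> = \<bar>Re u\<bar> / l" "\<bar>G \<i> z\<bar> = \<bar>Im u\<bar> / l"
  proof -
    have "\<i> * g z / f z = \<i> * u" by (simp add: u_def)
    then show "\<bar>G \<i> z\<bar> = \<bar>Im u\<bar> / l" by (simp add: G_def l_def)
  qed (simp add: G_def l_def u_def)
  ultimately have "T z \<le> 2 * max \<bar>G 1 z\<bar> \<bar>G \<i> z\<bar>" by (simp add: add_divide_distrib)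
  moreover have "0 \<le> T z" by (simp add: T_def)
  ultimately have "T z powr p \<le> (2 * max \<bar>G 1 z\<bar> \<bar>G \<i> z\<bar>) powr p" using assms by (intro powr_mono2) auto
  also have "\<dots> = 2 powr p * (max \<bar>G 1 z\<bar> \<bar>G \<i> z\<bar>) powr p" by (rule powr_mult)
  also have "\<dots> \<le> 2 powr p * (\<bar>G 1 z\<bar> powr p + \<bar>G \<i> z\<bar> powr p)"
    by (intro mult_left_mono) (auto simp: max_def)
  finally show ?thesis .
qed

end

lemma Lp_loc_top_imp_integrable_powr:
  fixes w :: "'a::euclidean_space \<Rightarrow> real"
  assumes w: "w \<in> Lp_loc \<infinity> U" and q: "q \<ge> 0" and S: "compact S" "S \<subseteq> U"
  shows "integrable (lebesgue_on S) (\<lambda>x. \<bar>w x\<bar> powr q)"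
proof -
  obtain C where C: "AE x in lebesgue_on S. \<bar>w x\<bar> \<le> C"
    using w S by (auto simp: Lp_loc_def)
  have "w \<in> borel_measurable (lebesgue_on U)" using w by (simp add: Lp_loc_def)
  then have meas [measurable]: "w \<in> borel_measurable (lebesgue_on S)" by (rule measurable_restrict_mono[OF _ S(2)])
  have fin: "finite_measure (lebesgue_on S)"
    using S(1) by (intro finite_measure_lebesgue_on lmeasurable_compact)
  show ?thesis
  proof (rule Bochner_Integration.integrable_bound)
    show "integrable (lebesgue_on S) (\<lambda>x. C powr q)"
      using fin by (rule finite_measure.integrable_const)
    show "AE x in lebesgue_on S. norm (\<bar>w x\<bar> powr q) \<le> norm (C powr q)"
      using C by eventually_elim (auto intro!: powr_mono2 q)
  qed simp
qed

text \<open>Replaces the extended exponent by a real one: \<open>enn2real p\<close> if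
  \<open>p\<close> is finite, and 3 if \<open>p = \<infinity>\<close>, where essential boundedness
  on compact sets makes every nonnegative power integrable.\<close>

lemma Lp_loc_gt_2_imp_integrable_powr:
  fixes U :: "'a::euclidean_space set"
  assumes p: "p > 2"
  obtains q where "q > 2" "\<And>w S. w \<in> Lp_loc p U \<Longrightarrow> compact S \<Longrightarrow> S \<subseteq> U \<Longrightarrow>
    integrable (lebesgue_on S) (\<lambda>x. \<bar>w x\<bar> powr q)"
proof (cases "p = \<infinity>")
  case True
  show thesis
    by (rule that[of 3], simp, rule Lp_loc_top_imp_integrable_powr) (simp_all add: True)
next
  case False
  then obtain r where r: "p = ennreal r" "r \<ge> 0" by (cases p) auto
  have "enn2real p > 2"
    using p r by (simp add: ennreal_less_iff flip: ennreal_numeral)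
  then show thesis
    by (rule that) (use False in \<open>auto simp: Lp_loc_def\<close>)
qed

context holomorphic_direction
begin

lemma v_not_W1_loc:
  assumes p: "p > 2"
    and ball: "ball x r \<subseteq> U" "a \<in> ball x r" "f a = 0" "a + axis i s \<in> ball x r" "f (a + axis i s) \<noteq> 0"
  shows "v \<notin> W1_loc p U"
proof
  assume v: "v \<in> W1_loc p U"
  obtain q where q: "q > 2" "\<And>w S. w \<in> Lp_loc p U \<Longrightarrow> compact S \<Longrightarrow> S \<subseteq> U \<Longrightarrow>
      integrable (lebesgue_on S) (\<lambda>x. \<bar>w x\<bar> powr q)"
    using Lp_loc_gt_2_imp_integrable_powr[OF p, of U] by metis
  obtain C where C: "compact C" "C \<subseteq> U" "(\<integral>\<^sup>+z. ennreal (T z powr q) * indicator C z \<partial>lborel) = \<infinity>"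
    by (rule T_powr_integral_infinite[OF q(1) ball])
  have Cb [measurable]: "C \<in> sets borel" using C(1) by (rule borel_compact)
  have int: "integrable lborel (\<lambda>z. indicator C z * \<bar>G c z\<bar> powr q)" if c: "axis i c \<in> Basis" "cmod c = 1" for c
  proof -
    obtain w where w: "w \<in> Lp_loc p U" "has_weak_partial U (axis i c) v w"
      using v c(1) unfolding W1_loc_def by blast
    have ae: "AE z in lebesgue. z \<in> U \<longrightarrow> w z = G c z"
      by (rule weak_partial_unique[OF open_U w(2) v_weak_partial[OF c]])
    have "integrable (lebesgue_on C) (\<lambda>x. \<bar>w x\<bar> powr q)" by (rule q(2)[OF w(1) C(1,2)])
    then have "integrable lebesgue (\<lambda>z. indicator C z *\<^sub>R \<bar>w z\<bar> powr q)"
      by (subst (asm) integrable_restrict_space) auto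
    then have "integrable lebesgue (\<lambda>z. indicator C z *\<^sub>R \<bar>G c z\<bar> powr q)"
    proof (rule integrable_cong_AE_imp)
      show "(\<lambda>z. indicator C z *\<^sub>R \<bar>G c z\<bar> powr q) \<in> borel_measurable lebesgue"
        by (intro measurable_completion) measurable
      show "AE z in lebesgue. indicator C z *\<^sub>R \<bar>w z\<bar> powr q = indicator C z *\<^sub>R \<bar>G c z\<bar> powr q"
        using ae by eventually_elim (use C(2) in \<open>auto simp: indicator_def\<close>)
    qed
    then show ?thesis by (subst (asm) integrable_completion) auto
  qed
  have "integrable lborel (\<lambda>z. 2 powr q * (indicator C z * \<bar>G 1 z\<bar> powr q + indicator C z * \<bar>G \<i> z\<bar> powr q))"
    by (intro integrable_mult_right Bochner_Integration.integrable_add int axis_in_Basis) auto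
  then have "(\<integral>\<^sup>+z. ennreal (norm (2 powr q * (indicator C z * \<bar>G 1 z\<bar> powr q + indicator C z * \<bar>G \<i> z\<bar> powr q))) \<partial>lborel) < \<infinity>"
    by (simp only: integrable_iff_bounded)
  moreover have "(\<integral>\<^sup>+z. ennreal (T z powr q) * indicator C z \<partial>lborel)
      \<le> (\<integral>\<^sup>+z. ennreal (norm (2 powr q * (indicator C z * \<bar>G 1 z\<bar> powr q + indicator C z * \<bar>G \<i> z\<bar> powr q))) \<partial>lborel)"
    using T_powr_le[of q] q(1) by (intro nn_integral_mono) (auto simp: indicator_def intro!: ennreal_leI)
  ultimately show False using C(3) by simp
qed

end

section \<open>Both statements for functions prescribed on \<open>U\<close> only\<close>

lemma holomorphic_vec_on_cong:
  assumes "\<And>z. z \<in> U \<Longrightarrow> f z = h z" "holomorphic_vec_on f U"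
  shows "holomorphic_vec_on h U"
  using assms unfolding holomorphic_vec_on_def by (metis has_derivative_transform)

theorem theorem1p3:
  fixes U :: "(complex ^ 'n) set"
    and f :: "complex ^ 'n \<Rightarrow> complex"
    and v :: "complex ^ 'n \<Rightarrow> real"
  assumes "open U" and "connected U" and "U \<noteq> {}"
    and "holomorphic_vec_on f U"
    and "\<not> f constant_on U"
    and "\<And>z. z \<in> U \<Longrightarrow> cmod (f z) < 1 / 2"
    and "\<And>z. z \<in> U \<Longrightarrow> v z = (if f z = 0 then 0 else 1 / ln (cmod (f z)))"
  shows "v \<in> W1_loc 2 U \<and>
    ({z \<in> U. f z = 0} \<noteq> {} \<longrightarrow> (\<forall>p::ennreal. p > 2 \<longrightarrow> v \<notin> W1_loc p U))"
proof -
  define F where "F z = (if z \<in> U then f z else 0)" for z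
  have hol: "holomorphic_vec_on F U"
    by (rule holomorphic_vec_on_cong[OF _ assms(4)]) (simp add: F_def)
  \<comment> \<open>The locale assumptions do not mention the coordinate \<open>i\<close>, so this
    one fact serves all directions.\<close>
  have dir: "holomorphic_direction U F" 
    by unfold_locales (use assms(1,6) hol in \<open>auto simp: F_def\<close>)
  define w where "w = holomorphic_direction.v F"
  have w: "w z = v z" if "z \<in> U" for z
    using assms(7)[OF that] that unfolding w_def holomorphic_direction.v_def[OF dir] by (simp add: F_def)
  have "w \<in> W1_loc 2 U"
    unfolding W1_loc_def mem_Collect_eq
  proof (intro conjI ballI)
    show "w \<in> Lp_loc 2 U"
      unfolding w_def by (rule holomorphic_direction.v_Lp_loc[OF dir]) simp
    fix b :: "complex ^ 'n" assume b: "b \<in> Basis"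
    then obtain i c where ic: "b = axis i c" "c \<in> Basis" by (auto simp: Basis_vec_def)
    have c: "cmod c = 1" using ic(2) by (rule norm_Basis)
    have "has_weak_partial U (axis i c) w (holomorphic_direction.G U F i c)"
      unfolding w_def using b c ic(1) by (intro holomorphic_direction.v_weak_partial[OF dir]) auto
    then show "\<exists>g\<in>Lp_loc 2 U. has_weak_partial U b w g"
      unfolding ic(1) using holomorphic_direction.G_Lp_loc(2)[OF dir c] by blast
  qed
  then have "v \<in> W1_loc 2 U" by (rule W1_loc_cong[rotated]) (rule w)
  moreover have "v \<notin> W1_loc p U" if ne: "{z \<in> U. f z = 0} \<noteq> {}" and p: "p > 2" for p
  proof
    assume "v \<in> W1_loc p U"
    then have W: "w \<in> W1_loc p U" by (rule W1_loc_cong[rotated]) (simp add: w)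
    obtain z0 where z0: "z0 \<in> U" "F z0 = 0" using ne by (auto simp: F_def)
    obtain z1 where z1: "z1 \<in> U" "F z1 \<noteq> 0"
      using assms(5) unfolding constant_on_def F_def by metis
    obtain a i s x r where "ball x r \<subseteq> U" "a \<in> ball x r" "F a = 0" "a + axis i s \<in> ball x r" "F (a + axis i s) \<noteq> 0"
      by (rule zero_nonconstant_along_axis[OF assms(1,2) hol z0 z1])
    then show False
      using holomorphic_direction.v_not_W1_loc[OF dir p] W unfolding w_def by blast
  qed
  ultimately show ?thesis by blast
qed

end
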